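(* Let $\mathbb{F}$ be an arbitrary field with $\operatorname{char}(\mathbb{F}) \neq 2$, let $n \geq 3$, let $1 \leq k \leq n-1$, and let $T: \operatorname{Mat}_{n}(\mathbb{F}) \to \operatorname{Mat}_{n}(\mathbb{F})$ be a linear bijective map. Then $T(\Lambda^{\leq k}) \subseteq \Lambda^{\leq k}$ if and only if there exist permutations $\sigma_1, \sigma_2 \in S_n$ and diagonal matrices $D_1, D_2 \in \operatorname{Mat}_n(\mathbb{F})$ with nonzero diagonal elements such that either $T(A) = D_1 P(\sigma_1) A P(\sigma_2) D_2$ for all $A \in \operatorname{Mat}_n(\mathbb{F})$, or $T(A) = D_1 P(\sigma_1) A^T P(\sigma_2) D_2$ for all $A \in \operatorname{Mat}_n(\mathbb{F})$.
   Context: $\operatorname{Mat}_n(\mathbb{F})$ is the space of $n\times n$ matrices over $\mathbb{F}$. The permanental rank $\operatorname{prk}(A)$ of $A \in \operatorname{Mat}_n(\mathbb{F})$ is the size of the largest square submatrix of $A$ with nonzero permanent (it is $0$ for the zero matrix). $\Lambda^{\leq k} = \{A \in \operatorname{Mat}_n(\mathbb{F}) : \operatorname{prk}(A) \leq k\}$. For $\sigma \in S_n$, $P(\sigma) = (p_{ij})$ is the permutation matrix with $p_{ij} = 1$ if $j = \sigma^{-1}(i)$ and $p_{ij}=0$ otherwise. *)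

theory Defs
  imports "HOL-Analysis.Analysis"
begin

abbreviation mat_scale :: "'a::times \<Rightarrow> 'a^'n^'m \<Rightarrow> 'a^'n^'m"
  where "mat_scale c \<equiv> map_matrix ((*) c)"

definition permanent :: "'a::comm_semiring_1^'n^'n \<Rightarrow> 'a" where
  "permanent A = (\<Sum>p | p permutes UNIV. \<Prod>i\<in>UNIV. A $ i $ p i)"

text \<open>
  Permanent of the submatrix with row set \<open>I\<close> and column set \<open>J\<close>, where \<open>card I = card J\<close>:
  the permanent is insensitive to the order of rows and columns, so it is the sum over all
  bijections from \<open>I\<close> to \<open>J\<close>. Intersecting with the extensional functions makes each bijection
  count once. For empty \<open>I\<close> and \<open>J\<close> the value is 1.
\<close>

definition sub_permanent :: "'a::comm_semiring_1^'n^'m \<Rightarrow> 'm set \<Rightarrow> 'n set \<Rightarrow> 'a" where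
  "sub_permanent A I J = (\<Sum>f | f \<in> I \<rightarrow>\<^sub>E J \<and> bij_betw f I J. \<Prod>i\<in>I. A $ i $ f i)"

definition prk :: "'a::comm_semiring_1^'n^'n \<Rightarrow> nat" where
  "prk A = Max {card I | I J. card I = card J \<and> sub_permanent A I J \<noteq> 0}"

definition prk_le :: "nat \<Rightarrow> ('a::comm_semiring_1^'n^'n) set" where
  "prk_le k = {A. prk A \<le> k}"

definition perm_matrix :: "('n \<Rightarrow> 'n) \<Rightarrow> 'a::zero_neq_one^'n^'n" where
  "perm_matrix \<sigma> = (\<chi> i j. if j = inv \<sigma> i then 1 else 0)"

definition diagonal_matrix :: "'a::zero^'n^'n \<Rightarrow> bool" where
  "diagonal_matrix D \<longleftrightarrow> (\<forall>i j. i \<noteq> j \<longrightarrow> D $ i $ j = 0)"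

text \<open>
  \<open>sub_permanent\<close> agrees with \<open>permanent\<close> of the submatrix selected by injective row and
  column indexings.
\<close>

lemma permanent_submatrix:
  fixes A :: "'a::comm_semiring_1^'n^'m" and r :: "'k::finite \<Rightarrow> 'm" and c :: "'k \<Rightarrow> 'n"
  assumes r: "inj r" and c: "inj c"
  shows "permanent (\<chi> i j. A $ r i $ c j) = sub_permanent A (range r) (range c)"
proof -
  let ?h = "\<lambda>p. restrict (c \<circ> p \<circ> inv r) (range r)"
  let ?g = "\<lambda>f. inv c \<circ> f \<circ> r"
  have r': "bij_betw r UNIV (range r)" and c': "bij_betw c UNIV (range c)"
    using r c by (auto simp: bij_betw_def)
  have ir: "bij_betw (inv r) (range r) UNIV" and ic: "bij_betw (inv c) (range c) UNIV"
    using bij_betw_inv_into[OF r'] bij_betw_inv_into[OF c'] by auto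
  show ?thesis
    unfolding permanent_def sub_permanent_def
  proof (rule sum.reindex_bij_witness[where i = ?g and j = ?h])
    fix p :: "'k \<Rightarrow> 'k" assume "p \<in> {p. p permutes UNIV}"
    then have p: "bij p" by (simp add: permutes_imp_bij)
    show "?g (?h p) = p"
      using r c by (auto simp: fun_eq_iff)
    have "bij_betw (c \<circ> p \<circ> inv r) (range r) (range c)"
      by (intro bij_betw_trans[OF ir] bij_betw_trans[OF p] c')
    then have "bij_betw (?h p) (range r) (range c)"
      by (simp add: bij_betw_def image_restrict_eq inj_on_restrict_eq)
    then show "?h p \<in> {f \<in> range r \<rightarrow>\<^sub>E range c. bij_betw f (range r) (range c)}"
      by (auto simp: bij_betw_def)
    show "(\<Prod>i\<in>range r. A $ i $ ?h p i) = (\<Prod>i\<in>UNIV. (\<chi> i j. A $ r i $ c j) $ i $ p i)"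
      using r by (subst prod.reindex) auto
  next
    fix f assume f: "f \<in> {f \<in> range r \<rightarrow>\<^sub>E range c. bij_betw f (range r) (range c)}"
    then have "bij (?g f)"
      by (auto intro!: bij_betw_trans[OF r'] bij_betw_trans[OF _ ic])
    then show "?g f \<in> {p. p permutes UNIV}"
      using bij_imp_permutes[of "?g f" UNIV] by blast
    show "?h (?g f) = f"
    proof
      fix x
      show "?h (?g f) x = f x"
      proof (cases "x \<in> range r")
        case True
        then have "f x \<in> range c" using f by auto
        with True show ?thesis by (simp add: f_inv_into_f)
      next
        case False
        with f show ?thesis by (auto simp: PiE_def extensional_def)
      qed
    qed
  qed
qed

corollary permanent_eq_sub_permanent: "permanent A = sub_permanent A UNIV UNIV"
  using permanent_submatrix[of id id A] by simp

lemma vector_space_mat_scale: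
  "vector_space (mat_scale :: 'a::field \<Rightarrow> 'a^'n^'m \<Rightarrow> 'a^'n^'m)"
  by unfold_locales (auto simp: map_matrix_def vec_eq_iff algebra_simps)

lemma finite_prk_set:
  "finite {card I | I J. card I = card J \<and> sub_permanent A I J \<noteq> 0}"
  by (rule finite_subset[of _ "card ` UNIV"]) auto

lemma prk_0: "prk (0 :: 'a::comm_semiring_1^'n^'n) = 0"
proof -
  have *: "card I = card J \<and> sub_permanent (0 :: 'a^'n^'n) I J \<noteq> 0 \<longleftrightarrow> I = {} \<and> J = {}" for I J
  proof (cases "I = {}")
    case True
    then show ?thesis
      by (cases "J = {}") (simp_all add: sub_permanent_def bij_betw_def)
  next
    case False
    then have "card I > 0" by (simp add: card_gt_0_iff)
    then have "sub_permanent (0 :: 'a^'n^'n) I J = 0"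
      by (simp add: sub_permanent_def zero_power del: card_gt_0_iff)
    with False show ?thesis by blast
  qed
  show ?thesis
    unfolding prk_def * by simp
qed

end

theory Submission
  imports Defs
begin

text \<open>
  Let \<open>W\<close> be a linear space of matrices of permanental rank at most \<open>k\<close>, and let \<open>L\<close> be the set of
  leading positions of its nonzero elements for a fixed lexicographic order. As in Meshulam's
  argument for the usual rank, multilinearity of the permanent shows that no \<open>k + 1\<close> positions of \<open>L\<close>
  lie on a common diagonal. Since the grid is a union of \<open>n\<close> disjoint diagonals, \<open>card L \<le> n k\<close>, and
  equality forces \<open>L\<close> to be a union of \<open>k\<close> rows or of \<open>k\<close> columns. So if \<open>dim W = n k\<close>, then \<open>W\<close> is the
  graph of a linear map over these lines, and that map vanishes because the only relations
  \<open>x\<^sub>a l\<^sub>b(x) + x\<^sub>b l\<^sub>a(x) = 0\<close> valid for all \<open>a \<noteq> b\<close> are trivial when \<open>n \<ge> 3\<close> and the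
  characteristic is not 2. Hence \<open>W\<close> consists of all matrices supported on \<open>L\<close>.

  It follows that a preserver permutes the spaces of matrices supported on \<open>k\<close> parallel lines. A
  single position is an intersection of such unions of lines, so matrix units go to multiples of
  matrix units. The induced map of positions preserves collinearity, hence permutes rows and columns
  up to a transposition, and the scalars form a matrix whose \<open>2 \<times> 2\<close> minors vanish.
\<close>

section \<open>Permanents of submatrices\<close>

lemma sub_permanent_nonzeroE:
  assumes "sub_permanent A I J \<noteq> 0"
  obtains f where "bij_betw f I J" "\<And>i. i \<in> I \<Longrightarrow> A $ i $ f i \<noteq> 0"
proof -
  from assms obtain f where f: "f \<in> {f \<in> I \<rightarrow>\<^sub>E J. bij_betw f I J}"
    and "(\<Prod>i\<in>I. A $ i $ f i) \<noteq> 0"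
    unfolding sub_permanent_def by (rule sum.not_neutral_contains_not_neutral)
  moreover from this(2) have "A $ i $ f i \<noteq> 0" if "i \<in> I" for i
    using that by (metis (no_types, lifting) finite_class.finite_code prod_zero)
  ultimately show thesis using that by blast
qed

lemma sub_permanent_cong:
  assumes "\<And>i j. i \<in> I \<Longrightarrow> j \<in> J \<Longrightarrow> A $ i $ j = B $ i $ j"
  shows "sub_permanent A I J = sub_permanent B I J"
  unfolding sub_permanent_def
  by (intro sum.cong prod.cong refl assms) (auto simp: PiE_def Pi_def)

text \<open>Every product along a bijection has exactly one factor from row \<open>m\<close>. The
  three matrices are compared on the rows in \<open>I\<close> only, so they may differ freely
  elsewhere.\<close>

lemma sub_permanent_row_add:
  fixes A B C :: "'a::comm_semiring_1^'n^'m"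
  assumes "m \<in> I" "A $ m = B $ m + C $ m"
    and "\<And>i. i \<in> I \<Longrightarrow> i \<noteq> m \<Longrightarrow> A $ i = B $ i"
    and "\<And>i. i \<in> I \<Longrightarrow> i \<noteq> m \<Longrightarrow> A $ i = C $ i"
  shows "sub_permanent A I J = sub_permanent B I J + sub_permanent C I J"
proof -
  have "(\<Prod>i\<in>I. A $ i $ f i) = (\<Prod>i\<in>I. B $ i $ f i) + (\<Prod>i\<in>I. C $ i $ f i)" for f
  proof -
    have B: "(\<Prod>i\<in>I-{m}. B $ i $ f i) = (\<Prod>i\<in>I-{m}. A $ i $ f i)"
      and C: "(\<Prod>i\<in>I-{m}. C $ i $ f i) = (\<Prod>i\<in>I-{m}. A $ i $ f i)"
      using assms(3,4) by (auto intro!: prod.cong)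
    have I: "prod g I = g m * prod g (I - {m})" for g :: "_ \<Rightarrow> 'a"
      using \<open>m \<in> I\<close> by (simp add: prod.remove)
    show ?thesis
      unfolding I[of "\<lambda>i. A $ i $ f i"] I[of "\<lambda>i. B $ i $ f i"] I[of "\<lambda>i. C $ i $ f i"] B C
      by (simp add: assms(2) distrib_right)
  qed
  then show ?thesis
    unfolding sub_permanent_def by (simp add: sum.distrib)
qed

text \<open>A bijection from \<open>insert s I\<close> onto \<open>J\<close> amounts to its value
  \<open>j\<close> at \<open>s\<close> together with a bijection from \<open>I\<close> onto
  \<open>J - {j}\<close>.\<close>

lemma sub_permanent_laplace:
  assumes "s \<notin> I"
  shows "sub_permanent A (insert s I) J =
    (\<Sum>j\<in>J. A $ s $ j * sub_permanent A I (J - {j}))"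
proof -
  let ?F = "\<lambda>I J. {f. f \<in> I \<rightarrow>\<^sub>E J \<and> bij_betw f I J}"
  have "(\<Sum>j\<in>J. A $ s $ j * sub_permanent A I (J - {j})) =
      (\<Sum>(j, f)\<in>(SIGMA j:J. ?F I (J - {j})). A $ s $ j * (\<Prod>i\<in>I. A $ i $ f i))"
    unfolding sub_permanent_def sum_distrib_left by (subst sum.Sigma) auto
  also have "\<dots> = (\<Sum>f\<in>?F (insert s I) J. \<Prod>i\<in>insert s I. A $ i $ f i)"
  proof (rule sum.reindex_bij_witness[where i = "\<lambda>f. (f s, restrict f I)"
        and j = "\<lambda>(j, f). f(s := j)"])
    fix f assume f: "f \<in> ?F (insert s I) J"
    then have "bij_betw f (insert s I) J" by simp
    then have "bij_betw f I (J - {f s})"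
      using assms by (auto simp: bij_betw_def inj_on_def)
    then have "bij_betw (restrict f I) I (J - {f s})"
      by (simp cong: bij_betw_cong)
    moreover have "f s \<in> J" using f by (auto simp: bij_betw_def)
    ultimately show "(f s, restrict f I) \<in> (SIGMA j:J. ?F I (J - {j}))"
      by (auto simp: bij_betw_def)
    show "(case (f s, restrict f I) of (j, f) \<Rightarrow> f(s := j)) = f"
      using f by (auto simp: fun_eq_iff PiE_def extensional_def)
  next
    fix q assume q: "q \<in> (SIGMA j:J. ?F I (J - {j}))"
    obtain j f where qq: "q = (j, f)" by (cases q)
    with q have f: "j \<in> J" "f \<in> I \<rightarrow>\<^sub>E J - {j}" "bij_betw f I (J - {j})" by auto
    have "bij_betw (f(s := j)) I (J - {j})"
      using f(3) assms by (subst bij_betw_cong[of _ _ f]) auto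
    then have "bij_betw (f(s := j)) (insert s I) (insert j (J - {j}))"
      using assms notIn_Un_bij_betw[of s I "f(s := j)" "J - {j}"] by simp
    then have "bij_betw (f(s := j)) (insert s I) J"
      using f(1) by (simp add: insert_absorb)
    then show "(case q of (j, f) \<Rightarrow> f(s := j)) \<in> ?F (insert s I) J"
      using f qq by (auto simp: PiE_def extensional_def)
    show "((case q of (j, f) \<Rightarrow> f(s := j)) s, restrict (case q of (j, f) \<Rightarrow> f(s := j)) I) = q"
      using f assms qq by (auto simp: fun_eq_iff PiE_def extensional_def)
    have "(\<Prod>i\<in>I. A $ i $ (f(s := j)) i) = (\<Prod>i\<in>I. A $ i $ f i)"
      using assms by (intro prod.cong) auto
    then show "(\<Prod>i\<in>insert s I. A $ i $ (case q of (j, f) \<Rightarrow> f(s := j)) i) =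
        (case q of (j, f) \<Rightarrow> A $ s $ j * (\<Prod>i\<in>I. A $ i $ f i))"
      using assms qq by (simp add: prod.insert)
  qed
  finally show ?thesis by (simp add: sub_permanent_def)
qed

lemma sub_permanent_empty [simp]: "sub_permanent A {} {} = 1"
proof -
  have "{f::'c \<Rightarrow> 'b. f \<in> {} \<rightarrow>\<^sub>E {} \<and> bij_betw f {} {}} = {\<lambda>x. undefined}"
    by (auto simp: bij_betw_def)
  then show ?thesis by (simp add: sub_permanent_def)
qed

lemma sub_permanent_2x2:
  assumes "r \<noteq> p" "a \<noteq> b"
  shows "sub_permanent A {r, p} {a, b} = A $ r $ a * A $ p $ b + A $ r $ b * A $ p $ a"
proof -
  have 1: "sub_permanent A {p} {j} = A $ p $ j" for j
    using sub_permanent_laplace[of p "{}" A "{j}"] by simp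
  have "{a, b} - {a} = {b}" "{a, b} - {b} = {a}" using assms by auto
  then show ?thesis
    using assms sub_permanent_laplace[of r "{p}" A "{a, b}"] by (simp add: 1)
qed

text \<open>Among the chosen columns, row \<open>s\<close> in \<open>I'\<close> can be nonzero only
  in column \<open>c s\<close>. Expansion along these rows strips them off one by one and leaves a 2
  by 2 permanent, which turns vanishing permanents of order \<open>k + 1\<close> into quadratic
  relations between four entries.\<close>

lemma sub_permanent_monomial_rows:
  assumes "finite I'" "r \<notin> I'" "p \<notin> I'" "r \<noteq> p" "a \<notin> c ` I'" "b \<notin> c ` I'" "a \<noteq> b" "inj_on c I'"
    and "\<And>s j. s \<in> I' \<Longrightarrow> j \<in> insert a (insert b (c ` I')) \<Longrightarrow> j \<noteq> c s \<Longrightarrow> A $ s $ j = 0"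
  shows "sub_permanent A (I' \<union> {r, p}) (c ` I' \<union> {a, b}) =
    (\<Prod>s\<in>I'. A $ s $ c s) * (A $ r $ a * A $ p $ b + A $ r $ b * A $ p $ a)"
  using assms
proof (induction I' rule: finite_induct)
  case empty
  then show ?case by (simp add: sub_permanent_2x2)
next
  case (insert s I)
  have s: "s \<notin> I \<union> {r, p}" using insert.hyps insert.prems by auto
  let ?J = "c ` insert s I \<union> {a, b}"
  have J: "?J - {c s} = c ` I \<union> {a, b}"
    using insert.hyps insert.prems by (auto simp: inj_on_def)
  have "sub_permanent A (insert s I \<union> {r, p}) ?J =
      (\<Sum>j\<in>?J. A $ s $ j * sub_permanent A (I \<union> {r, p}) (?J - {j}))"
    using sub_permanent_laplace[OF s, of A ?J] by (simp only: Un_insert_left)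
  also have "\<dots> = (\<Sum>j\<in>{c s}. A $ s $ j * sub_permanent A (I \<union> {r, p}) (?J - {j}))"
  proof (rule sum.mono_neutral_right)
    show "\<forall>j\<in>?J - {c s}. A $ s $ j * sub_permanent A (I \<union> {r, p}) (?J - {j}) = 0"
    proof
      fix j assume "j \<in> ?J - {c s}"
      then have "A $ s $ j = 0" by (intro insert.prems(8)) auto
      then show "A $ s $ j * sub_permanent A (I \<union> {r, p}) (?J - {j}) = 0" by simp
    qed
  qed auto
  also have "\<dots> = A $ s $ c s * sub_permanent A (I \<union> {r, p}) (c ` I \<union> {a, b})"
    by (simp only: sum.insert sum.empty J finite.emptyI empty_iff not_False_eq_True add_0_right)
  also have "sub_permanent A (I \<union> {r, p}) (c ` I \<union> {a, b}) =
      (\<Prod>s\<in>I. A $ s $ c s) * (A $ r $ a * A $ p $ b + A $ r $ b * A $ p $ a)"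
    by (rule insert.IH) (use insert.prems in \<open>auto simp: inj_on_def\<close>)
  finally show ?case using insert.hyps by (simp add: mult.assoc)
qed

lemma restrict_inv_into_bij:
  assumes "f \<in> I \<rightarrow>\<^sub>E J" "bij_betw f I J"
  shows "bij_betw (restrict (inv_into I f) J) J I"
    and "restrict (inv_into J (restrict (inv_into I f) J)) I = f"
proof -
  have "bij_betw (inv_into I f) J I" using assms(2) by (rule bij_betw_inv_into)
  then show b: "bij_betw (restrict (inv_into I f) J) J I"
    by (simp cong: bij_betw_cong)
  show "restrict (inv_into J (restrict (inv_into I f) J)) I = f"
  proof
    fix x
    show "restrict (inv_into J (restrict (inv_into I f) J)) I x = f x"
    proof (cases "x \<in> I")
      case True
      have "f x \<in> J" "inv_into I f (f x) = x"
        using assms True by (auto simp: bij_betw_def)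
      then have "inv_into J (restrict (inv_into I f) J) x = f x"
        using b by (intro inv_into_f_eq) (auto simp: bij_betw_def)
      with True show ?thesis by simp
    next
      case False
      then show ?thesis using assms by (auto simp: PiE_def extensional_def)
    qed
  qed
qed

lemma sub_permanent_transpose: "sub_permanent (transpose A) I J = sub_permanent A J I"
  unfolding sub_permanent_def
proof (rule sum.reindex_bij_witness[where i = "\<lambda>g. restrict (inv_into J g) I"
      and j = "\<lambda>f. restrict (inv_into I f) J"])
  fix f assume f: "f \<in> {f \<in> I \<rightarrow>\<^sub>E J. bij_betw f I J}"
  then have b: "bij_betw f I J" and r: "bij_betw (restrict (inv_into I f) J) J I"
    using restrict_inv_into_bij by auto
  show "restrict (inv_into J (restrict (inv_into I f) J)) I = f"
    using f restrict_inv_into_bij(2) by auto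
  show "restrict (inv_into I f) J \<in> {f \<in> J \<rightarrow>\<^sub>E I. bij_betw f J I}"
    using r by (auto simp: bij_betw_def)
  have "(\<Prod>j\<in>J. A $ j $ restrict (inv_into I f) J j) =
      (\<Prod>i\<in>I. A $ f i $ restrict (inv_into I f) J (f i))"
    using prod.reindex_bij_betw[OF b, of "\<lambda>j. A $ j $ restrict (inv_into I f) J j"] by simp
  also have "\<dots> = (\<Prod>i\<in>I. transpose A $ i $ f i)"
    using b by (intro prod.cong) (auto simp: bij_betw_def transpose_def)
  finally show "(\<Prod>j\<in>J. A $ j $ restrict (inv_into I f) J j) = (\<Prod>i\<in>I. transpose A $ i $ f i)" .
next
  fix f assume f: "f \<in> {f \<in> J \<rightarrow>\<^sub>E I. bij_betw f J I}"
  show "restrict (inv_into I (restrict (inv_into J f) I)) J = f"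
    using f restrict_inv_into_bij(2) by auto
  show "restrict (inv_into J f) I \<in> {f \<in> I \<rightarrow>\<^sub>E J. bij_betw f I J}"
    using f restrict_inv_into_bij(1)[of f J I] by (auto simp: bij_betw_def)
qed

lemma sub_permanent_scale_permute:
  fixes A B :: "'a::comm_semiring_1^'n^'m"
  assumes "bij \<alpha>" "bij \<beta>" and B: "\<And>i j. B $ i $ j = a i * A $ \<alpha> i $ \<beta> j * b j"
  shows "sub_permanent B I J = prod a I * prod b J * sub_permanent A (\<alpha> ` I) (\<beta> ` J)"
proof -
  have \<alpha>: "bij_betw \<alpha> I (\<alpha> ` I)" and \<beta>: "bij_betw \<beta> J (\<beta> ` J)"
    using assms by (auto simp: bij_betw_def inj_on_def)
  have ib: "bij_betw (inv \<beta>) (\<beta> ` J) J"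
    using assms(2) by (auto simp: bij_betw_def inj_on_def image_image)
  have ia: "bij_betw (inv \<alpha>) (\<alpha> ` I) I"
    using assms(1) by (auto simp: bij_betw_def inj_on_def image_image)
  have [simp]: "inv \<alpha> (\<alpha> x) = x" "inv \<beta> (\<beta> y) = y" "\<beta> (inv \<beta> y) = y" for x y
    using assms by (auto simp: bij_betw_def surj_f_inv_f)
  have "(\<Sum>f | f \<in> I \<rightarrow>\<^sub>E J \<and> bij_betw f I J. \<Prod>i\<in>I. B $ i $ f i) =
     (\<Sum>f | f \<in> \<alpha> ` I \<rightarrow>\<^sub>E \<beta> ` J \<and> bij_betw f (\<alpha> ` I) (\<beta> ` J).
        prod a I * prod b J * (\<Prod>i\<in>\<alpha> ` I. A $ i $ f i))"
  proof (rule sum.reindex_bij_witness[where i = "\<lambda>g. restrict (inv \<beta> \<circ> g \<circ> \<alpha>) I"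
        and j = "\<lambda>f. restrict (\<beta> \<circ> f \<circ> inv \<alpha>) (\<alpha> ` I)"])
    fix f assume f: "f \<in> {f \<in> I \<rightarrow>\<^sub>E J. bij_betw f I J}"
    then show "restrict (inv \<beta> \<circ> restrict (\<beta> \<circ> f \<circ> inv \<alpha>) (\<alpha> ` I) \<circ> \<alpha>) I = f"
      by (auto simp: fun_eq_iff PiE_def extensional_def)
    have "bij_betw (\<beta> \<circ> f \<circ> inv \<alpha>) (\<alpha> ` I) (\<beta> ` J)"
      using f by (intro bij_betw_trans[OF ia] bij_betw_trans[OF _ \<beta>]) auto
    then have "bij_betw (restrict (\<beta> \<circ> f \<circ> inv \<alpha>) (\<alpha> ` I)) (\<alpha> ` I) (\<beta> ` J)"
      by (simp add: bij_betw_def image_restrict_eq inj_on_restrict_eq)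
    then show "restrict (\<beta> \<circ> f \<circ> inv \<alpha>) (\<alpha> ` I) \<in>
        {f \<in> \<alpha> ` I \<rightarrow>\<^sub>E \<beta> ` J. bij_betw f (\<alpha> ` I) (\<beta> ` J)}"
      using f by auto
    have "(\<Prod>i\<in>\<alpha> ` I. A $ i $ restrict (\<beta> \<circ> f \<circ> inv \<alpha>) (\<alpha> ` I) i) =
        (\<Prod>i\<in>I. A $ \<alpha> i $ \<beta> (f i))"
      using prod.reindex_bij_betw[OF \<alpha>, of "\<lambda>i. A $ i $ restrict (\<beta> \<circ> f \<circ> inv \<alpha>) (\<alpha> ` I) i"]
      by simp
    moreover have "prod b J = (\<Prod>i\<in>I. b (f i))"
      using f prod.reindex_bij_betw[of f I J b] by simp
    ultimately show "prod a I * prod b J *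
        (\<Prod>i\<in>\<alpha> ` I. A $ i $ restrict (\<beta> \<circ> f \<circ> inv \<alpha>) (\<alpha> ` I) i) = (\<Prod>i\<in>I. B $ i $ f i)"
      by (simp add: B prod.distrib mult_ac)
  next
    fix f assume f: "f \<in> {f \<in> \<alpha> ` I \<rightarrow>\<^sub>E \<beta> ` J. bij_betw f (\<alpha> ` I) (\<beta> ` J)}"
    then show "restrict (\<beta> \<circ> restrict (inv \<beta> \<circ> f \<circ> \<alpha>) I \<circ> inv \<alpha>) (\<alpha> ` I) = f"
      by (auto simp: fun_eq_iff PiE_def extensional_def)
    have "bij_betw (inv \<beta> \<circ> f \<circ> \<alpha>) I J"
      using f by (intro bij_betw_trans[OF \<alpha>] bij_betw_trans[OF _ ib]) auto
    then have r: "bij_betw (restrict (inv \<beta> \<circ> f \<circ> \<alpha>) I) I J"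
      by (simp add: bij_betw_def image_restrict_eq inj_on_restrict_eq)
    have "(inv \<beta> \<circ> f \<circ> \<alpha>) i \<in> J" if "i \<in> I" for i
    proof -
      have "f (\<alpha> i) \<in> \<beta> ` J" using f that by blast
      then show ?thesis by auto
    qed
    with r show "restrict (inv \<beta> \<circ> f \<circ> \<alpha>) I \<in> {f \<in> I \<rightarrow>\<^sub>E J. bij_betw f I J}"
      by simp
  qed
  then show ?thesis
    by (simp add: sub_permanent_def sum_distrib_left)
qed

text \<open>If the product along a bijection \<open>g\<close> is nonzero, then
  \<open>h (g i)\<close> is at most \<open>h (f i)\<close> for every \<open>i\<close> in
  \<open>I\<close>. Both sides have the same sum, because \<open>g\<close> and \<open>f\<close> have
  the same image, so equality holds throughout and injectivity of \<open>h\<close> leaves only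
  \<open>f\<close>.\<close>

lemma sub_permanent_triangular:
  fixes A :: "'a::comm_semiring_1^'n^'m" and h :: "'n \<Rightarrow> nat"
  assumes "inj h" "inj_on f I" and A: "\<And>i j. i \<in> I \<Longrightarrow> h (f i) < h j \<Longrightarrow> A $ i $ j = 0"
  shows "sub_permanent A I (f ` I) = (\<Prod>i\<in>I. A $ i $ f i)"
proof -
  have zero: "(\<Prod>i\<in>I. A $ i $ g i) = 0"
    if g: "g \<in> I \<rightarrow>\<^sub>E f ` I" "bij_betw g I (f ` I)" "g \<noteq> restrict f I" for g
  proof (rule ccontr)
    assume "(\<Prod>i\<in>I. A $ i $ g i) \<noteq> 0"
    then have "A $ i $ g i \<noteq> 0" if "i \<in> I" for i
      using that by (metis (no_types, lifting) finite_class.finite_code prod_zero)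
    then have le: "h (g i) \<le> h (f i)" if "i \<in> I" for i
      using A that by (meson not_le_imp_less)
    have "(\<Sum>i\<in>I. h (g i)) = (\<Sum>i\<in>I. h (f i))"
      using sum.reindex_bij_betw[OF g(2), of h] sum.reindex[OF assms(2), of h] by simp
    then have "h (g i) = h (f i)" if "i \<in> I" for i
      using sum_mono_inv[of "\<lambda>i. h (g i)" I "\<lambda>i. h (f i)"] le that by auto
    then have "g i = f i" if "i \<in> I" for i
      using \<open>inj h\<close> that by (meson injD)
    then have "g = restrict f I"
      using g(1) by (auto simp: fun_eq_iff PiE_def extensional_def)
    with g(3) show False ..
  qed
  have "sub_permanent A I (f ` I) = (\<Sum>g\<in>{restrict f I}. \<Prod>i\<in>I. A $ i $ g i)"
    unfolding sub_permanent_def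
  proof (rule sum.mono_neutral_right)
    show "{restrict f I} \<subseteq> {g \<in> I \<rightarrow>\<^sub>E f ` I. bij_betw g I (f ` I)}"
      using assms(2) by (auto simp: bij_betw_def inj_on_restrict_eq)
  qed (use zero in auto)
  then show ?thesis by simp
qed

section \<open>Matrices of permanental rank at most \<open>k\<close>\<close>

lemma prk_le_iff:
  fixes A :: "'a::comm_semiring_1^'n^'n"
  shows "A \<in> prk_le k \<longleftrightarrow>
    (\<forall>I J. card I = card J \<longrightarrow> k < card I \<longrightarrow> sub_permanent A I J = 0)"
proof -
  let ?S = "{card I | I J. card I = card J \<and> sub_permanent A I J \<noteq> 0}"
  have "finite ?S" by (rule finite_prk_set)
  \<comment> \<open>The empty submatrix has permanent 1, so the maximum defining \<open>prk\<close>
    ranges over a nonempty set.\<close>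
  moreover have "sub_permanent A {} {} \<noteq> 0" by simp
  then have "?S \<noteq> {}" by blast
  ultimately have *: "A \<in> prk_le k \<longleftrightarrow> (\<forall>s\<in>?S. s \<le> k)"
    unfolding prk_le_def prk_def mem_Collect_eq by (rule Max_le_iff)
  show ?thesis
  proof
    assume A: "A \<in> prk_le k"
    show "\<forall>I J. card I = card J \<longrightarrow> k < card I \<longrightarrow> sub_permanent A I J = 0"
    proof (intro allI impI, rule ccontr)
      fix I J :: "'n set" assume c: "card I = card J" "k < card I" "sub_permanent A I J \<noteq> 0"
      then have "card I \<in> ?S" by blast
      with A * have "card I \<le> k" by blast
      with c(2) show False by simp
    qed
  next
    assume A: "\<forall>I J. card I = card J \<longrightarrow> k < card I \<longrightarrow> sub_permanent A I J = 0"
    have "s \<le> k" if s: "s \<in> ?S" for s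
    proof -
      obtain I J where "s = card I" "card I = card J" "sub_permanent A I J \<noteq> 0"
        using s by blast
      with A show ?thesis by (meson not_le)
    qed
    with * show "A \<in> prk_le k" by blast
  qed
qed

lemma prk_leD: "A \<in> prk_le k \<Longrightarrow> card I = card J \<Longrightarrow> k < card I \<Longrightarrow> sub_permanent A I J = 0"
  by (rule prk_le_iff[THEN iffD1, rule_format])

lemma transpose_in_prk_le: "A \<in> prk_le k \<Longrightarrow> transpose A \<in> prk_le k"
  unfolding prk_le_iff[of "transpose A"] sub_permanent_transpose
  by (intro allI impI prk_leD[of A k]) simp_all

lemma scale_permute_in_prk_le:
  fixes A B :: "'a::comm_semiring_1^'n^'n"
  assumes "A \<in> prk_le k" "bij \<alpha>" "bij \<beta>" and "\<And>i j. B $ i $ j = a i * A $ \<alpha> i $ \<beta> j * b j"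
  shows "B \<in> prk_le k"
  unfolding prk_le_iff
proof (intro allI impI)
  fix I J :: "'n set" assume "card I = card J" "k < card I"
  moreover have "card (\<alpha> ` I) = card I" "card (\<beta> ` J) = card J"
    using assms(2,3) by (simp_all add: card_image bij_is_inj inj_on_subset[OF _ subset_UNIV])
  ultimately have "sub_permanent A (\<alpha> ` I) (\<beta> ` J) = 0"
    by (intro prk_leD[OF assms(1)]) simp_all
  then show "sub_permanent B I J = 0"
    using sub_permanent_scale_permute[where B = B and A = A, OF assms(2-4)] by simp
qed

text \<open>
  The matrices \<open>N t u\<close> have rows \<open>v i $ i\<close> where \<open>h i < t\<close> and the rows of \<open>u\<close> elsewhere. If \<open>h m = t\<close>,
  then \<open>v m\<close> vanishes in all rows \<open>i\<close> with \<open>h i > t\<close>, so \<open>N t (u + v m)\<close> and \<open>N t u\<close> differ in row \<open>m\<close>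
  only, and additivity of the permanent in that row turns their two vanishing permanents into the
  vanishing permanent of \<open>N (t + 1) u\<close>. This replaces polarization and works over every domain.
\<close>

lemma card_leading_positions_le:
  fixes W :: "('a::idom^'n^'n) set" and h :: "'n \<Rightarrow> nat"
  assumes W: "0 \<in> W" "\<And>u v. u \<in> W \<Longrightarrow> v \<in> W \<Longrightarrow> u + v \<in> W" "W \<subseteq> prk_le k"
    and "inj h" "inj_on f I"
    and v: "\<And>i. i \<in> I \<Longrightarrow> v i \<in> W" "\<And>i. i \<in> I \<Longrightarrow> v i $ i $ f i \<noteq> 0"
      "\<And>i i'. i \<in> I \<Longrightarrow> h i < h i' \<Longrightarrow> v i $ i' = 0"
      "\<And>i j. i \<in> I \<Longrightarrow> h (f i) < h j \<Longrightarrow> v i $ i $ j = 0"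
  shows "card I \<le> k"
proof (rule ccontr)
  assume "\<not> card I \<le> k"
  then have big: "k < card I" "card I = card (f ` I)"
    using \<open>inj_on f I\<close> by (auto simp: card_image)
  define N where "N t u = (\<chi> i. if h i < t then v i $ i else u $ i)" for t u
  have N0: "\<forall>u\<in>W. sub_permanent (N t u) I (f ` I) = 0" for t
  proof (induction t)
    case 0
    then show ?case using W(3) big by (auto simp: N_def vec_lambda_eta intro: prk_leD)
  next
    case (Suc t)
    show ?case
    proof
      fix u assume u: "u \<in> W"
      show "sub_permanent (N (Suc t) u) I (f ` I) = 0"
      proof (cases "\<exists>m\<in>I. h m = t")
        case True
        then obtain m where m: "m \<in> I" "h m = t" by blast
        have i: "h i < t \<or> t < h i" if "i \<noteq> m" for i
          using m that \<open>inj h\<close> by (metis injD linorder_neqE_nat)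
        have "sub_permanent (N t (u + v m)) I (f ` I) =
            sub_permanent (N (Suc t) u) I (f ` I) + sub_permanent (N t u) I (f ` I)"
        proof (rule sub_permanent_row_add)
          show "N t (u + v m) $ m = N (Suc t) u $ m + N t u $ m"
            using m by (simp add: N_def add.commute)
          fix l assume l: "l \<noteq> m"
          show "N t (u + v m) $ l = N t u $ l" "N t (u + v m) $ l = N (Suc t) u $ l"
            using i[OF l] v(3)[OF m(1), of l] m(2) by (auto simp: N_def)
        qed (rule m)
        then show ?thesis
          using Suc u W(2)[OF u v(1)[OF m(1)]] by simp
      next
        case False
        then have "sub_permanent (N (Suc t) u) I (f ` I) = sub_permanent (N t u) I (f ` I)"
          by (intro sub_permanent_cong) (auto simp: N_def less_Suc_eq)
        then show ?thesis using Suc u by simp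
      qed
    qed
  qed
  \<comment> \<open>Beyond all values of \<open>h\<close>, every row of \<open>N ?t 0\<close> comes
    from the matrices \<open>v i\<close>. The condition on leading columns makes it triangular along
    \<open>f\<close> with nonzero diagonal entries, so its permanent cannot vanish.\<close>
  let ?t = "Suc (Max (range h))"
  have t: "h i < ?t" for i by (simp add: le_imp_less_Suc)
  have "sub_permanent (N ?t 0) I (f ` I) = (\<Prod>i\<in>I. N ?t 0 $ i $ f i)"
    using v(4) t by (intro sub_permanent_triangular[OF \<open>inj h\<close> \<open>inj_on f I\<close>]) (simp add: N_def)
  also have "\<dots> \<noteq> 0" using v(2) t by (simp add: N_def)
  finally show False using N0 W(1) by blast
qed

section \<open>Diagonals of a square grid\<close>

lemma mod_add_right_inj_nat:
  fixes x y t N :: nat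
  assumes "(x + t) mod N = (y + t) mod N" "x < N" "y < N"
  shows "x = y"
proof -
  have *: "x = y" if "(x + t) mod N = (y + t) mod N" "y < N" "x \<le> y" for x y
  proof -
    have "N dvd (y + t) - (x + t)"
      using that by (subst mod_eq_dvd_iff_nat[symmetric]) auto
    with that show ?thesis by (auto dest: dvd_imp_le)
  qed
  show ?thesis using *[of x y] *[of y x] assms by (metis linear)
qed

text \<open>Cyclic shifts, transported along an enumeration of the type, split the grid into
  disjoint diagonals. Shift 0 is the identity, so composing all shifts with a given bijection makes
  that bijection one of the diagonals.\<close>

lemma cyclic_latin_square:
  obtains s :: "nat \<Rightarrow> 'n::finite \<Rightarrow> 'n"
  where "\<And>t. bij (s t)" "s 0 = id" "\<And>i. bij_betw (\<lambda>t. s t i) {..<CARD('n)} UNIV"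
proof -
  let ?N = "CARD('n)"
  obtain e :: "nat \<Rightarrow> 'n" where e: "bij_betw e {..<?N} UNIV"
    using ex_bij_betw_nat_finite[of "UNIV :: 'n set"] by (auto simp: atLeast0LessThan)
  define d where "d = inv_into {..<?N} e"
  have d: "d i < ?N" "e (d i) = i" for i
    using e bij_betw_inv_into[OF e]
    by (auto simp: d_def bij_betw_def f_inv_into_f)
  define s where "s t i = e ((d i + t) mod ?N)" for t i
  have e_eq: "e (x mod ?N) = e (y mod ?N) \<longleftrightarrow> x mod ?N = y mod ?N" for x y
    using e by (auto simp: bij_betw_def inj_on_def)
  have "inj (s t)" for t
  proof (rule injI)
    fix i i' assume "s t i = s t i'"
    then have "d i = d i'" using d(1) mod_add_right_inj_nat unfolding s_def e_eq by blast
    then show "i = i'" using d(2) by metis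
  qed
  then have "bij (s t)" for t by (simp add: finite_UNIV_inj_surj bij_betw_def)
  moreover have "s 0 = id" using d by (auto simp: s_def)
  moreover have "bij_betw (\<lambda>t. s t i) {..<?N} UNIV" for i
  proof -
    have "inj_on (\<lambda>t. s t i) {..<?N}"
    proof (rule inj_onI)
      fix t t' assume t: "t \<in> {..<?N}" "t' \<in> {..<?N}" and "s t i = s t' i"
      then have "(t + d i) mod ?N = (t' + d i) mod ?N" by (simp add: s_def e_eq add.commute)
      then show "t = t'" using t by (intro mod_add_right_inj_nat[of t "d i" ?N t']) auto
    qed
    moreover from this have "(\<lambda>t. s t i) ` {..<?N} = UNIV"
      by (intro card_subset_eq) (auto simp: card_image)
    ultimately show ?thesis by (simp add: bij_betw_def)
  qed
  ultimately show thesis by (rule that)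
qed

lemma ex_bij_two_values:
  assumes "i \<noteq> i'" "j \<noteq> j'"
  obtains \<sigma> :: "'n \<Rightarrow> 'n" where "bij \<sigma>" "\<sigma> i = j" "\<sigma> i' = j'"
proof
  let ?\<tau> = "Transposition.transpose i j"
  let ?\<sigma> = "Transposition.transpose (?\<tau> i') j' \<circ> ?\<tau>"
  show "bij ?\<sigma>" by (intro bij_comp) auto
  \<comment> \<open>The second transposition must leave \<open>j\<close>, the value already arranged
    at \<open>i\<close>, in place.\<close>
  have "?\<tau> i' \<noteq> j" using assms(1) by (metis transpose_eq_imp_eq transpose_apply_first)
  then show "?\<sigma> i = j" using assms by (simp add: transpose_def)
  show "?\<sigma> i' = j'" by simp
qed

text \<open>
  The grid is a disjoint union of \<open>CARD('n)\<close> diagonals, one of which may be prescribed; hence every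
  diagonal meets \<open>L\<close> in exactly \<open>k\<close> positions, and swapping two values of a permutation gives an
  exchange property for \<open>L\<close>.
\<close>

lemma large_set_with_small_diagonals:
  fixes L :: "('n::finite \<times> 'n) set"
  assumes le: "\<And>\<sigma>. bij \<sigma> \<Longrightarrow> card {i. (i, \<sigma> i) \<in> L} \<le> k" and L: "CARD('n) * k \<le> card L"
  obtains R where "card R = k" "L = R \<times> UNIV" | C where "card C = k" "L = UNIV \<times> C"
proof -
  define x :: "'n \<Rightarrow> 'n \<Rightarrow> nat" where "x i j = of_bool ((i, j) \<in> L)" for i j
  have card_x: "card {i. (i, \<sigma> i) \<in> L} = (\<Sum>i\<in>UNIV. x i (\<sigma> i))" for \<sigma>
    by (simp add: x_def)
  obtain s :: "nat \<Rightarrow> 'n \<Rightarrow> 'n" where s: "\<And>t. bij (s t)" "s 0 = id"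
    "\<And>i. bij_betw (\<lambda>t. s t i) {..<CARD('n)} UNIV"
    by (rule cyclic_latin_square) blast
  have cardL: "card L = (\<Sum>i\<in>UNIV. \<Sum>j\<in>UNIV. x i j)"
  proof -
    have "card (SIGMA i:UNIV. {j. (i, j) \<in> L}) = (\<Sum>i\<in>UNIV. card {j. (i, j) \<in> L})"
      by (rule card_SigmaI) auto
    moreover have "(SIGMA i:UNIV. {j. (i, j) \<in> L}) = L" by auto
    ultimately have "card L = (\<Sum>i\<in>UNIV. card {j. (i, j) \<in> L})" by simp
    then show ?thesis by (simp add: x_def)
  qed
  have eq: "(\<Sum>i\<in>UNIV. x i (\<sigma> i)) = k" if \<sigma>: "bij \<sigma>" for \<sigma>
  proof -
    have b: "bij_betw (\<lambda>t. \<sigma> (s t i)) {..<CARD('n)} UNIV" for i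
      using bij_betw_trans[OF s(3)[of i] \<sigma>] by (simp add: comp_def)
    have le': "(\<Sum>i\<in>UNIV. x i (\<sigma> (s t i))) \<le> k" for t
      using le[OF bij_comp[OF s(1) \<sigma>], of t] card_x[of "\<sigma> \<circ> s t"] by simp
    have "(\<Sum>t<CARD('n). \<Sum>i\<in>UNIV. x i (\<sigma> (s t i))) = (\<Sum>i\<in>UNIV. \<Sum>t<CARD('n). x i (\<sigma> (s t i)))"
      by (rule sum.swap)
    also have "\<dots> = card L"
      unfolding cardL by (intro sum.cong refl sum.reindex_bij_betw b)
    \<comment> \<open>The diagonals partition the grid, so their counts add up to
      \<open>card L\<close>, which is at least \<open>CARD('n) * k\<close>. As no count exceeds
      \<open>k\<close>, each of them equals \<open>k\<close>.\<close>
    finally have "(\<Sum>t<CARD('n). \<Sum>i\<in>UNIV. x i (\<sigma> (s t i))) = (\<Sum>t<CARD('n). k)"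
      using L sum_mono[of "{..<CARD('n)}" "\<lambda>t. \<Sum>i\<in>UNIV. x i (\<sigma> (s t i))" "\<lambda>_. k"] le'
      by simp
    then have "(\<Sum>i\<in>UNIV. x i (\<sigma> (s 0 i))) = k"
      by (rule sum_mono_inv) (use le' in \<open>auto simp: card_gt_0_iff\<close>)
    then show ?thesis by (simp add: s(2))
  qed
  \<comment> \<open>Two bijections that differ only by swapping the values \<open>j\<close> and
    \<open>j'\<close> at \<open>i\<close> and \<open>i'\<close> have the same count
    \<open>k\<close>. Cancelling the common terms leaves the exchange identity.\<close>
  have exch: "x i j + x i' j' = x i j' + x i' j" if ne: "i \<noteq> i'" "j \<noteq> j'" for i i' j j'
  proof -
    obtain \<sigma> where \<sigma>: "bij \<sigma>" "\<sigma> i = j" "\<sigma> i' = j'" using ex_bij_two_values[OF ne] .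
    define \<rho> where "\<rho> = \<sigma> \<circ> Transposition.transpose i i'"
    have \<rho>: "bij \<rho>" "\<rho> i = j'" "\<rho> i' = j" "\<And>l. l \<noteq> i \<Longrightarrow> l \<noteq> i' \<Longrightarrow> \<rho> l = \<sigma> l"
      unfolding \<rho>_def using \<sigma> by (auto intro!: bij_comp simp: transpose_def)
    have split: "(\<Sum>l\<in>UNIV. g l) = g i + g i' + (\<Sum>l\<in>UNIV - {i, i'}. g l)" for g :: "'n \<Rightarrow> nat"
      using ne by (subst sum.subset_diff[of "{i, i'}"]) auto
    have "(\<Sum>l\<in>UNIV - {i, i'}. x l (\<rho> l)) = (\<Sum>l\<in>UNIV - {i, i'}. x l (\<sigma> l))"
      using \<rho>(4) by (intro sum.cong) auto
    with eq[OF \<sigma>(1)] eq[OF \<rho>(1)] show ?thesis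
      unfolding split[of "\<lambda>l. x l (\<sigma> l)"] split[of "\<lambda>l. x l (\<rho> l)"] \<sigma> \<rho> by simp
  qed
  have diag: "card {i. (i, i) \<in> L} = k" using eq[of id] card_x[of id] by simp
  show thesis
  proof (cases "\<exists>i j j'. (i, j) \<in> L \<and> (i, j') \<notin> L")
    case False
    define R where "R = {i. (i, i) \<in> L}"
    have "L = R \<times> UNIV" unfolding R_def using False by auto
    moreover have "card R = k" unfolding R_def by (rule diag)
    ultimately show thesis using that(1) by blast
  next
    case True
    then obtain i j j' where ij: "(i, j) \<in> L" "(i, j') \<notin> L" by blast
    then have "j \<noteq> j'" by auto
    \<comment> \<open>With entries 0 and 1, exchange against row \<open>i\<close> gives
      \<open>1 + x l j' = x l j\<close>, which has only one solution.\<close>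
    then have all: "(l, j) \<in> L \<and> (l, j') \<notin> L" for l
      using exch[of i l j j'] ij by (cases "l = i") (auto simp: x_def of_bool_def split: if_splits)
    define C where "C = {i. (i, i) \<in> L}"
    \<comment> \<open>All rows already agree in the columns \<open>j\<close> and \<open>j'\<close>,
      and exchanging column \<open>c\<close> with one of these transfers the agreement to
      \<open>c\<close>. The main diagonal then lists the columns of \<open>L\<close>.\<close>
    have "(a, c) \<in> L \<longleftrightarrow> (b, c) \<in> L" for a b c
    proof (rule ccontr)
      assume "\<not> ?thesis"
      then obtain a b where ab: "(a, c) \<in> L" "(b, c) \<notin> L" by blast
      then have "c \<noteq> j" "a \<noteq> b" using all by auto
      then show False
        using exch[of a b c j'] exch[of a b c j] ab all[of a] all[of b]
        by (cases "c = j'") (auto simp: x_def)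
    qed
    then have "L = UNIV \<times> C" unfolding C_def by auto
    moreover have "card C = k" unfolding C_def by (rule diag)
    ultimately show thesis using that(2) by blast
  qed
qed

section \<open>Matrix units and matrices with prescribed support\<close>

definition unit_mat :: "'n \<times> 'n \<Rightarrow> 'a::zero_neq_one^'n^'n" where
  "unit_mat p = (\<chi> i j. if (i, j) = p then 1 else 0)"

definition supported_on :: "('n \<times> 'n) set \<Rightarrow> ('a::zero^'n^'n) set" where
  "supported_on S = {A. \<forall>i j. (i, j) \<notin> S \<longrightarrow> A $ i $ j = 0}"

lemma unit_mat_nth: "unit_mat p $ i $ j = (if (i, j) = p then 1 else 0)"
  by (simp add: unit_mat_def)

lemma mat_scale_nth [simp]: "mat_scale c A $ i $ j = c * A $ i $ j"
  by (simp add: map_matrix_def)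

lemma unit_mat_supported_on_iff [simp]: "unit_mat p \<in> supported_on S \<longleftrightarrow> p \<in> S"
  by (cases p) (auto simp: supported_on_def unit_mat_nth)

lemma inj_unit_mat: "inj (unit_mat :: _ \<Rightarrow> 'a::zero_neq_one^'n^'n)"
proof (rule injI)
  fix p q assume "(unit_mat p :: 'a^'n^'n) = unit_mat q"
  then have "(unit_mat p :: 'a^'n^'n) $ fst p $ snd p = unit_mat q $ fst p $ snd p" by simp
  then show "p = q" by (simp add: unit_mat_nth split: if_splits)
qed

lemma supported_on_expand:
  fixes A :: "'a::comm_semiring_1^'n^'n"
  assumes "A \<in> supported_on S"
  shows "A = (\<Sum>p\<in>S. mat_scale (A $ fst p $ snd p) (unit_mat p))"
  using assms
  by (auto simp: vec_eq_iff supported_on_def unit_mat_nth if_distrib[of "(*) _"] cong: if_cong)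

lemma independent_unit_mat:
  "\<not> module.dependent mat_scale (range unit_mat :: ('a::field^'n^'n) set)"
proof -
  interpret vector_space "mat_scale :: 'a \<Rightarrow> 'a^'n^'n \<Rightarrow> _" by (rule vector_space_mat_scale)
  show ?thesis
  proof (rule independent_if_scalars_zero)
    fix f :: "'a^'n^'n \<Rightarrow> 'a" and u :: "'a^'n^'n"
    assume 0: "(\<Sum>u\<in>range unit_mat. mat_scale (f u) u) = 0" and "u \<in> range unit_mat"
    then obtain p :: "'n \<times> 'n" where u: "u = unit_mat p" by blast
    have "0 = (\<Sum>q\<in>UNIV. mat_scale (f (unit_mat q)) (unit_mat q)) $ fst p $ snd p"
      using 0 sum.reindex[OF inj_unit_mat, of "\<lambda>u. mat_scale (f u) u"] by (simp add: comp_def)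
    also have "\<dots> = f u"
      by (simp add: unit_mat_nth u if_distrib[of "(*) _"] cong: if_cong)
    finally show "f u = 0" by simp
  qed simp
qed

text \<open>Supplies spans and dimensions for matrices over an arbitrary field, with the matrix
  units as basis.\<close>

interpretation mat: finite_dimensional_vector_space
  "mat_scale :: 'a::field \<Rightarrow> 'a^'n^'n \<Rightarrow> 'a^'n^'n" "range unit_mat"
proof -
  interpret vector_space "mat_scale :: 'a \<Rightarrow> 'a^'n^'n \<Rightarrow> _" by (rule vector_space_mat_scale)
  have "A \<in> span (range unit_mat)" for A :: "'a^'n^'n"
    by (subst supported_on_expand[of A UNIV], simp add: supported_on_def)
      (intro span_sum span_scale span_base rangeI)
  then show "finite_dimensional_vector_space (mat_scale :: 'a \<Rightarrow> 'a^'n^'n \<Rightarrow> _) (range unit_mat)"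
    by unfold_locales (auto simp: independent_unit_mat)
qed

interpretation mat: finite_dimensional_vector_space_pair_1
  "mat_scale :: 'a::field \<Rightarrow> 'a^'n^'n \<Rightarrow> 'a^'n^'n" "range unit_mat"
  "mat_scale :: 'a \<Rightarrow> 'a^'n^'n \<Rightarrow> 'a^'n^'n"
  by unfold_locales

lemma subspace_supported_on: "mat.subspace (supported_on S)"
  by (auto simp: mat.subspace_def supported_on_def)

lemma dim_supported_on: "mat.dim (supported_on S :: ('a::field^'n^'n) set) = card S"
proof (rule mat.dim_unique)
  show "unit_mat ` S \<subseteq> (supported_on S :: ('a^'n^'n) set)" by auto
  show "(supported_on S :: ('a^'n^'n) set) \<subseteq> mat.span (unit_mat ` S)"
  proof
    fix A :: "'a^'n^'n" assume "A \<in> supported_on S"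
    then have A: "A = (\<Sum>p\<in>S. mat_scale (A $ fst p $ snd p) (unit_mat p))"
      by (rule supported_on_expand)
    show "A \<in> mat.span (unit_mat ` S)"
      by (subst A) (intro mat.span_sum mat.span_scale mat.span_base imageI)
  qed
  show "mat.independent (unit_mat ` S :: ('a^'n^'n) set)"
    by (rule mat.independent_mono[OF independent_unit_mat]) auto
  show "card (unit_mat ` S :: ('a^'n^'n) set) = card S"
    by (rule card_image) (rule inj_on_subset[OF inj_unit_mat], simp)
qed

section \<open>Subspaces of maximal dimension\<close>

lemma ex_notin_if_card_less:
  fixes S :: "'n::finite set"
  assumes "card S < CARD('n)"
  obtains x where "x \<notin> S"
  using assms by (metis UNIV_eq_I less_irrefl)

text \<open>By \<open>lift\<close>, each matrix unit in a row of \<open>R\<close> is completed by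
  rows outside \<open>R\<close> to an element of \<open>W\<close>. The vanishing permanents of order
  \<open>k + 1\<close> show that these completing rows are zero, so \<open>W\<close> contains the
  matrix units themselves.\<close>

lemma supported_on_rows_subset:
  fixes W :: "('a::field^'n^'n) set"
  assumes sub: "mat.subspace W" and W: "W \<subseteq> prk_le k" and two: "(2::'a) \<noteq> 0"
    and n: "CARD('n) \<ge> 3" and k: "k \<le> CARD('n) - 1" and R: "card R = k"
    and lift: "\<And>X. X \<in> supported_on (R \<times> UNIV) \<Longrightarrow> \<exists>w\<in>W. \<forall>i\<in>R. w $ i = X $ i"
  shows "supported_on (R \<times> UNIV) \<subseteq> W"
proof -
  have key: "w $ r $ a * w $ p $ b + w $ r $ b * w $ p $ a = 0"
    if r: "r \<in> R" and p: "p \<notin> R" and ab: "a \<noteq> b" and w: "w \<in> W" "\<And>i. i \<in> R - {r} \<Longrightarrow> w $ i = 0"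
    for r p a b w
  proof -
    let ?I = "R - {r}"
    have "card ?I = k - 1" "card (- {a, b}) = CARD('n) - 2"
      using r R ab by (auto simp: Compl_eq_Diff_UNIV card_Diff_subset)
    then have "card ?I \<le> card (- {a, b})" using k by simp
    then obtain c where c: "c ` ?I \<subseteq> - {a, b}" "inj_on c ?I"
      using card_le_inj[of ?I "- {a, b}"] by auto
    \<comment> \<open>\<open>u\<close> has a one at \<open>(i, c i)\<close> in each row
      \<open>i\<close> of \<open>R - {r}\<close> and is zero in row \<open>r\<close>. Its rows
      outside \<open>R\<close> remain unknown.\<close>
    obtain u where u: "u \<in> W"
      "\<And>i. i \<in> R \<Longrightarrow> u $ i = (\<chi> i j. if i \<in> ?I \<and> j = c i then 1 else 0) $ i"
      using lift[of "\<chi> i j. if i \<in> ?I \<and> j = c i then 1 else 0"] by (auto simp: supported_on_def)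
    have kpos: "0 < k" using r R by (metis card_gt_0_iff empty_iff finite_class.finite_code)
    have cI: "card (?I \<union> {r, p}) = k + 1"
    proof -
      have "?I \<union> {r, p} = insert p R" using r by auto
      then show ?thesis using p R by simp
    qed
    have cJ: "card (c ` ?I \<union> {a, b}) = k + 1"
    proof -
      have "c ` ?I \<inter> {a, b} = {}" using c(1) by auto
      then have "card (c ` ?I \<union> {a, b}) = card (c ` ?I) + 2" using ab by (simp add: card_Un_disjoint)
      then show ?thesis using kpos r R c(2) by (simp add: card_image)
    qed
    have main: "v $ r $ a * (u + v) $ p $ b + v $ r $ b * (u + v) $ p $ a = 0"
      if v: "v \<in> W" "\<And>i. i \<in> ?I \<Longrightarrow> v $ i = 0" for v
    proof -
      have "u + v \<in> prk_le k" using mat.subspace_add[OF sub u(1) v(1)] W by blast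
      then have perm0: "sub_permanent (u + v) (?I \<union> {r, p}) (c ` ?I \<union> {a, b}) = 0"
        by (rule prk_leD) (use cI cJ in linarith)+
      have row: "(u + v) $ s $ j = (if j = c s then 1 else 0)" if "s \<in> ?I" for s j
        using u(2)[of s] v(2)[OF that] that by simp
      have "sub_permanent (u + v) (?I \<union> {r, p}) (c ` ?I \<union> {a, b}) =
          (\<Prod>s\<in>?I. (u + v) $ s $ c s) *
          ((u + v) $ r $ a * (u + v) $ p $ b + (u + v) $ r $ b * (u + v) $ p $ a)"
        by (rule sub_permanent_monomial_rows) (use p r c ab row in auto)
      moreover have "(\<Prod>s\<in>?I. (u + v) $ s $ c s) = 1"
        by (intro prod.neutral ballI) (simp add: row del: vector_add_component)
      ultimately have "(u + v) $ r $ a * (u + v) $ p $ b + (u + v) $ r $ b * (u + v) $ p $ a = 0"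
        unfolding perm0 by (simp only: mult_1)
      moreover have "u $ r $ j = 0" for j using u(2)[OF r] by simp
      ultimately show ?thesis by simp
    qed
    \<comment> \<open>Adding the relations for \<open>w\<close> and \<open>- w\<close> cancels the
      unknown entries of \<open>u\<close> in row \<open>p\<close>. What remains is twice the desired
      quadratic form in \<open>w\<close>.\<close>
    have "- w \<in> W" using sub w(1) by (simp add: mat.subspace_neg)
    then have "2 * (w $ r $ a * w $ p $ b + w $ r $ b * w $ p $ a) = 0"
      using main[of w] main[of "- w"] w by (simp add: algebra_simps)
    with two show ?thesis unfolding mult_eq_0_iff by blast
  qed
  have unit: "unit_mat (r, i) \<in> W" if r: "r \<in> R" for r i
  proof -
    have "\<exists>w\<in>W. \<forall>l\<in>R. w $ l = unit_mat (r, i) $ l" for i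
      by (rule lift) (simp add: r)
    then have "\<exists>z. \<forall>i. z i \<in> W \<and> (\<forall>l\<in>R. z i $ l = unit_mat (r, i) $ l)"
      by (intro choice) blast
    then obtain z where z: "\<And>i. z i \<in> W" "\<And>i l. l \<in> R \<Longrightarrow> z i $ l = unit_mat (r, i) $ l"
      by blast
    have zr: "z i $ r $ j = (if j = i then 1 else 0)" for i j
      using z(2)[OF r] by (simp add: unit_mat_nth)
    have z0: "z i $ l = 0" if "l \<in> R - {r}" for i l
      using z(2)[of l] that by (simp add: vec_eq_iff unit_mat_nth)
    \<comment> \<open>Row \<open>r\<close> of \<open>z i\<close> is a one in column
      \<open>i\<close>, so \<open>key\<close> with the columns \<open>i\<close> and \<open>b\<close>
      reduces to the single entry in row \<open>p\<close> and column \<open>b\<close>.\<close>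
    have off: "z i $ p $ b = 0" if "p \<notin> R" "b \<noteq> i" for p i b
      using key[OF r that(1), of i b "z i"] z(1) z0 zr that(2) by simp
    have anti: "z i $ p $ i + z j $ p $ j = 0" if p: "p \<notin> R" and "i \<noteq> j" for p i j
    proof -
      have "z i + z j \<in> W" using sub z(1) by (simp add: mat.subspace_add)
      then show ?thesis
        using key[OF r p \<open>i \<noteq> j\<close>, of "z i + z j"] z0 zr off[OF p] \<open>i \<noteq> j\<close> by (simp add: add.commute)
    qed
    \<comment> \<open>The entries indexed by three distinct columns have pairwise sums zero.
      Combining these sums gives twice one entry, which is where three columns and the nonvanishing
      of 2 enter.\<close>
    have diag: "z i $ p $ i = 0" if p: "p \<notin> R" for p
    proof -
      obtain j where j: "j \<notin> {i}" using ex_notin_if_card_less[of "{i}"] n by auto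
      have "card {i, j} < CARD('n)" using n j by simp
      then obtain l where l: "l \<notin> {i, j}" by (rule ex_notin_if_card_less)
      have ne: "i \<noteq> j" "i \<noteq> l" "j \<noteq> l" using j l by auto
      have "2 * z i $ p $ i = (z i $ p $ i + z j $ p $ j) + (z i $ p $ i + z l $ p $ l)
          - (z j $ p $ j + z l $ p $ l)" by simp
      also have "\<dots> = 0" by (simp only: anti[OF p ne(1)] anti[OF p ne(2)] anti[OF p ne(3)]) simp
      finally show ?thesis using two by (simp only: mult_eq_0_iff) blast
    qed
    have "z i = unit_mat (r, i)"
    proof -
      have "z i $ p $ j = unit_mat (r, i) $ p $ j" for p j
      proof (cases "p \<in> R")
        case True
        then show ?thesis by (simp only: z(2))
      next
        case False
        then have "z i $ p $ j = 0" using off diag by (cases "j = i") auto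
        with False r show ?thesis by (auto simp: unit_mat_nth)
      qed
      then show ?thesis by (simp add: vec_eq_iff)
    qed
    then show ?thesis using z(1)[of i] by simp
  qed
  show ?thesis
  proof
    fix A :: "'a^'n^'n" assume "A \<in> supported_on (R \<times> UNIV)"
    then have A: "A = (\<Sum>p\<in>R \<times> UNIV. mat_scale (A $ fst p $ snd p) (unit_mat p))"
      by (rule supported_on_expand)
    show "A \<in> W"
      by (subst A) (intro mat.subspace_sum[OF sub] mat.subspace_scale[OF sub], auto intro: unit)
  qed
qed

section \<open>Unions of \<open>k\<close> parallel lines as maximal supports\<close>

definition line_unions :: "nat \<Rightarrow> ('n \<times> 'n) set set" where
  "line_unions k = {R \<times> UNIV | R. card R = k} \<union> {UNIV \<times> C | C. card C = k}"

lemma card_line_unions: "S \<in> line_unions k \<Longrightarrow> card (S :: ('n::finite \<times> 'n) set) = CARD('n) * k"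
  by (auto simp: line_unions_def card_cartesian_product)

lemma supported_on_line_unions_prk_le:
  fixes S :: "('n::finite \<times> 'n) set"
  assumes "S \<in> line_unions k"
  shows "supported_on S \<subseteq> (prk_le k :: ('a::comm_semiring_1^'n^'n) set)"
proof
  fix A :: "'a^'n^'n" assume A: "A \<in> supported_on S"
  show "A \<in> prk_le k"
    unfolding prk_le_iff
  proof (intro allI impI, rule ccontr)
    fix I J :: "'n set" assume c: "card I = card J" "k < card I" and nz: "sub_permanent A I J \<noteq> 0"
    obtain f where f: "bij_betw f I J" "\<And>i. i \<in> I \<Longrightarrow> A $ i $ f i \<noteq> 0"
      using nz by (rule sub_permanent_nonzeroE) blast
    have "(i, f i) \<in> S" if "i \<in> I" for i
      using f(2)[OF that] A by (auto simp: supported_on_def)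
    then have S: "\<And>i. i \<in> I \<Longrightarrow> (i, f i) \<in> S" .
    from assms consider R where "card R = k" "S = R \<times> UNIV" | C where "card C = k" "S = UNIV \<times> C"
      by (auto simp: line_unions_def)
    then show False
    proof cases
      case 1
      then have "I \<subseteq> R" using S by auto
      then show False using 1 c card_mono[of R I] by simp
    next
      case 2
      then have "J \<subseteq> C" using S f(1) by (auto simp: bij_betw_def)
      then show False using 2 c card_mono[of C J] by simp
    qed
  qed
qed

lemma max_dim_subspace_prk_le:
  fixes W :: "('a::field^'n^'n) set"
  assumes sub: "mat.subspace W" and W: "W \<subseteq> prk_le k" and dim: "mat.dim W = CARD('n) * k"
    and two: "(2::'a) \<noteq> 0" and n: "CARD('n) \<ge> 3" and k: "k \<le> CARD('n) - 1"
  obtains S where "S \<in> line_unions k" "W = supported_on S"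
proof -
  obtain h :: "'n \<Rightarrow> nat" where h: "inj h"
    using finite_imp_inj_to_nat_seg[of "UNIV :: 'n set"] by auto
  have ex_max: "\<exists>x\<in>S. \<forall>y\<in>S. h y \<le> h x" if "S \<noteq> {}" for S
  proof -
    have "Max (h ` S) \<in> h ` S" using that by simp
    then obtain x where "x \<in> S" "h x = Max (h ` S)" by auto
    then show ?thesis by (intro bexI[of _ x]) auto
  qed
  \<comment> \<open>A leading position is found by taking the last nonzero row in the order of
    \<open>h\<close> and then the last nonzero entry of that row.\<close>
  define L where "L = {(i, j). \<exists>w\<in>W. w $ i $ j \<noteq> 0 \<and> (\<forall>i'. h i < h i' \<longrightarrow> w $ i' = 0) \<and>
    (\<forall>j'. h j < h j' \<longrightarrow> w $ i $ j' = 0)}"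
  have diag: "card {i. (i, \<sigma> i) \<in> L} \<le> k" if \<sigma>: "bij \<sigma>" for \<sigma>
  proof -
    have "\<forall>i\<in>{i. (i, \<sigma> i) \<in> L}. \<exists>w. w \<in> W \<and> w $ i $ \<sigma> i \<noteq> 0 \<and> (\<forall>i'. h i < h i' \<longrightarrow> w $ i' = 0) \<and>
        (\<forall>j'. h (\<sigma> i) < h j' \<longrightarrow> w $ i $ j' = 0)"
      by (auto simp: L_def)
    then obtain v where v: "\<forall>i\<in>{i. (i, \<sigma> i) \<in> L}. v i \<in> W \<and> v i $ i $ \<sigma> i \<noteq> 0 \<and>
        (\<forall>i'. h i < h i' \<longrightarrow> v i $ i' = 0) \<and> (\<forall>j'. h (\<sigma> i) < h j' \<longrightarrow> v i $ i $ j' = 0)"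
      by (rule bchoice[THEN exE])
    show ?thesis
    proof (rule card_leading_positions_le[OF _ _ W h])
      show "0 \<in> W" using sub by (rule mat.subspace_0)
      show "u + v \<in> W" if "u \<in> W" "v \<in> W" for u v using sub that by (rule mat.subspace_add)
      show "inj_on \<sigma> {i. (i, \<sigma> i) \<in> L}" using \<sigma> by (auto simp: bij_betw_def inj_on_def)
    qed (use v in blast)+
  qed
  \<comment> \<open>A nonzero element of \<open>W\<close> has its own leading position in
    \<open>L\<close> and cannot vanish there. Hence the projection \<open>P\<close> onto
    \<open>L\<close> is injective on \<open>W\<close>.\<close>
  have zero: "w = 0" if w: "w \<in> W" and wL: "\<And>i j. (i, j) \<in> L \<Longrightarrow> w $ i $ j = 0" for w
  proof (rule ccontr)
    assume "w \<noteq> 0"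
    then have "{i. w $ i \<noteq> 0} \<noteq> {}" by (auto simp: vec_eq_iff)
    from ex_max[OF this] obtain i where i: "w $ i \<noteq> 0" "\<forall>i'. w $ i' \<noteq> 0 \<longrightarrow> h i' \<le> h i"
      by auto
    from i(1) have "{j. w $ i $ j \<noteq> 0} \<noteq> {}" by (auto simp: vec_eq_iff)
    from ex_max[OF this] obtain j where j: "w $ i $ j \<noteq> 0" "\<forall>j'. w $ i $ j' \<noteq> 0 \<longrightarrow> h j' \<le> h j"
      by auto
    have "\<forall>i'. h i < h i' \<longrightarrow> w $ i' = 0" "\<forall>j'. h j < h j' \<longrightarrow> w $ i $ j' = 0"
      using i(2) j(2) not_le by blast+
    with w j(1) have "(i, j) \<in> L" unfolding L_def by blast
    with wL j show False by blast
  qed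
  define P :: "'a^'n^'n \<Rightarrow> 'a^'n^'n" where "P A = (\<chi> i j. if (i, j) \<in> L then A $ i $ j else 0)" for A
  have P: "Vector_Spaces.linear mat_scale mat_scale P"
    by (intro Vector_Spaces.linear_iff[THEN iffD2] conjI allI vector_space_mat_scale)
      (auto simp: P_def vec_eq_iff)
  have "inj_on P (mat.span W)"
  proof (rule inj_onI)
    fix u v assume uv: "u \<in> mat.span W" "v \<in> mat.span W" "P u = P v"
    have "mat.span W \<subseteq> W" by (rule mat.span_minimal[OF order_refl sub])
    with uv(1,2) have "u - v \<in> W" by (intro mat.subspace_diff[OF sub]) auto
    moreover have "(u - v) $ i $ j = 0" if "(i, j) \<in> L" for i j
      using uv(3) that by (auto simp: P_def vec_eq_iff split: if_splits)
    ultimately show "u = v" using zero by (metis right_minus_eq)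
  qed
  then have dimP: "mat.dim (P ` W) = CARD('n) * k"
    using mat.dim_image_eq[OF P] dim by simp
  have PW: "P ` W \<subseteq> supported_on L" by (auto simp: P_def supported_on_def)
  have "CARD('n) * k \<le> card L"
    using mat.dim_subset[OF PW] dimP by (simp add: dim_supported_on)
  \<comment> \<open>Once \<open>L\<close> is a union of \<open>k\<close> lines,
    \<open>card L\<close> equals \<open>mat.dim W\<close>. The injective projection is then onto, so
    prescribed entries on \<open>L\<close> always extend to an element of \<open>W\<close>.\<close>
  have lift: "\<exists>w\<in>W. \<forall>i j. (i, j) \<in> L \<longrightarrow> w $ i $ j = X $ i $ j"
    if L: "L \<in> line_unions k" and X: "X \<in> supported_on L" for X
  proof -
    have "P ` W = supported_on L"
    proof (rule mat.subspace_dim_equal[OF _ subspace_supported_on PW])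
      show "mat.subspace (P ` W)" using mat.linear_subspace_image[OF P sub] .
    qed (simp add: dimP dim_supported_on card_line_unions[OF L])
    then obtain w where "w \<in> W" "X = P w" using X by auto
    then show ?thesis by (auto simp: P_def)
  qed
  have eq: "W = supported_on L" if L: "L \<in> line_unions k" and "supported_on L \<subseteq> W"
    using mat.subspace_dim_equal[OF subspace_supported_on sub that(2)]
    by (simp add: dim dim_supported_on card_line_unions[OF L])
  show thesis
  proof (rule large_set_with_small_diagonals[OF diag \<open>CARD('n) * k \<le> card L\<close>])
    fix R assume R: "card R = k" "L = R \<times> UNIV"
    then have L: "L \<in> line_unions k" by (auto simp: line_unions_def)
    have "supported_on (R \<times> UNIV) \<subseteq> W"
    proof (rule supported_on_rows_subset[OF sub W two n k R(1)])
      fix X :: "'a^'n^'n" assume "X \<in> supported_on (R \<times> UNIV)"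
      then show "\<exists>w\<in>W. \<forall>i\<in>R. w $ i = X $ i"
        using lift[OF L, of X] by (auto simp: R(2) vec_eq_iff)
    qed
    then show thesis using that L eq R(2) by blast
  next
    fix C assume C: "card C = k" "L = UNIV \<times> C"
    then have L: "L \<in> line_unions k" by (auto simp: line_unions_def)
    have lin: "Vector_Spaces.linear mat_scale mat_scale (transpose :: 'a^'n^'n \<Rightarrow> _)"
      by (intro Vector_Spaces.linear_iff[THEN iffD2] conjI allI vector_space_mat_scale)
        (auto simp: transpose_def vec_eq_iff)
    \<comment> \<open>The column case is the row case for the transposed subspace.\<close>
    have *: "supported_on (C \<times> UNIV) \<subseteq> transpose ` W"
    proof (rule supported_on_rows_subset[OF _ _ two n k C(1)])
      show "mat.subspace (transpose ` W)"
        using mat.linear_subspace_image[OF lin sub] .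
      show "transpose ` W \<subseteq> prk_le k" using W transpose_in_prk_le by blast
      fix X :: "'a^'n^'n" assume "X \<in> supported_on (C \<times> UNIV)"
      then have "transpose X \<in> supported_on L" by (auto simp: supported_on_def transpose_def C(2))
      then show "\<exists>w\<in>transpose ` W. \<forall>i\<in>C. w $ i = X $ i"
        using lift[OF L, of "transpose X"] by (auto simp: C(2) vec_eq_iff transpose_def)
    qed
    have "supported_on L \<subseteq> W"
    proof
      fix X :: "'a^'n^'n" assume "X \<in> supported_on L"
      then have "transpose X \<in> supported_on (C \<times> UNIV)"
        by (auto simp: supported_on_def transpose_def C(2))
      then obtain w where "w \<in> W" "transpose X = transpose w" using * by blast
      then show "X \<in> W" by (metis transpose_transpose)
    qed
    then show thesis using that L eq by blast
  qed
qed

lemma obtain_card_between: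
  fixes X Y :: "'n::finite set"
  assumes "X \<inter> Y = {}" "card X \<le> m" "m + card Y \<le> CARD('n)"
  obtains I where "X \<subseteq> I" "I \<inter> Y = {}" "card I = m"
proof -
  have "card (- (X \<union> Y)) = CARD('n) - (card X + card Y)"
    using assms(1) by (simp add: Compl_eq_Diff_UNIV card_Diff_subset card_Un_disjoint)
  then have "m - card X \<le> card (- (X \<union> Y))" using assms by simp
  then obtain I where I: "I \<subseteq> - (X \<union> Y)" "card I = m - card X"
    by (meson obtain_subset_with_card_n)
  then have "card (X \<union> I) = m"
    using assms(2) by (subst card_Un_disjoint) auto
  then show thesis using that[of "X \<union> I"] I assms(1) by blast
qed

text \<open>Distinct positions differ in their row or in their column. Since \<open>k\<close> is
  smaller than the number of lines, such a line through \<open>p\<close> extends to \<open>k\<close>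
  parallel lines that avoid the one through \<open>q\<close>.\<close>

lemma line_unions_separate:
  fixes p q :: "'n::finite \<times> 'n"
  assumes "p \<noteq> q" "1 \<le> k" "k \<le> CARD('n) - 1"
  obtains S where "S \<in> line_unions k" "p \<in> S" "q \<notin> S"
proof -
  have *: "\<exists>R. x \<in> R \<and> y \<notin> R \<and> card R = k" if "x \<noteq> y" for x y :: 'n
  proof -
    have "k + 1 \<le> CARD('n)" using assms(3) zero_less_card_finite[where ?'a = 'n] by linarith
    then have c: "k + card {y} \<le> CARD('n)" "card {x} \<le> k" "{x} \<inter> {y} = {}"
      using assms(2) that by auto
    obtain R where "{x} \<subseteq> R" "R \<inter> {y} = {}" "card R = k"
      using obtain_card_between[OF c(3,2,1)] .
    then show ?thesis by blast
  qed
  show thesis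
  proof (cases "fst p = fst q")
    case True
    then have "snd p \<noteq> snd q" using assms(1) by (simp add: prod_eq_iff)
    then obtain C where "snd p \<in> C" "snd q \<notin> C" "card C = k" using * by blast
    then show thesis using that[of "UNIV \<times> C"] by (auto simp: line_unions_def mem_Times_iff)
  next
    case False
    then obtain C where "fst p \<in> C" "fst q \<notin> C" "card C = k" using * by blast
    then show thesis using that[of "C \<times> UNIV"] by (auto simp: line_unions_def mem_Times_iff)
  qed
qed

section \<open>Collinearity-preserving maps of the grid\<close>

definition collinear_pos :: "'n \<times> 'n \<Rightarrow> 'n \<times> 'n \<Rightarrow> bool" where
  "collinear_pos p q \<longleftrightarrow> fst p = fst q \<or> snd p = snd q"

text \<open>Two distinct collinear positions share exactly one line. A third position collinear with
  both must lie on that line.\<close>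

lemma row_to_line:
  fixes \<tau> :: "'n::finite \<times> 'n \<Rightarrow> 'n \<times> 'n"
  assumes inj: "inj \<tau>" and col: "\<And>p q. collinear_pos p q \<Longrightarrow> collinear_pos (\<tau> p) (\<tau> q)"
    and n: "CARD('n) \<ge> 2"
  shows "(\<exists>r. \<forall>j. fst (\<tau> (i, j)) = r) \<or> (\<exists>c. \<forall>j. snd (\<tau> (i, j)) = c)"
proof -
  have "card {i} < CARD('n)" using n by simp
  then obtain b where b: "b \<notin> {i}" by (rule ex_notin_if_card_less)
  have row: "collinear_pos (\<tau> (i, x)) (\<tau> (i, y))" for x y
    by (rule col) (simp add: collinear_pos_def)
  have ne: "\<tau> (i, i) \<noteq> \<tau> (i, b)" using b inj by (auto dest: injD)
  consider "fst (\<tau> (i, i)) = fst (\<tau> (i, b))" | "snd (\<tau> (i, i)) = snd (\<tau> (i, b))"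
    using row[of i b] by (auto simp: collinear_pos_def)
  then show ?thesis
  proof cases
    case 1
    then have "fst (\<tau> (i, j)) = fst (\<tau> (i, i))" for j
      using row[of j i] row[of j b] ne by (auto simp: collinear_pos_def prod_eq_iff)
    then show ?thesis by blast
  next
    case 2
    then have "snd (\<tau> (i, j)) = snd (\<tau> (i, i))" for j
      using row[of j i] row[of j b] ne by (auto simp: collinear_pos_def prod_eq_iff)
    then show ?thesis by blast
  qed
qed

lemma collinearity_preserver_rows:
  fixes \<tau> :: "'n::finite \<times> 'n \<Rightarrow> 'n \<times> 'n"
  assumes inj: "inj \<tau>" and col: "\<And>p q. collinear_pos p q \<Longrightarrow> collinear_pos (\<tau> p) (\<tau> q)"
    and n: "CARD('n) \<ge> 2" and row: "\<forall>j. fst (\<tau> (i\<^sub>0, j)) = r"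
  obtains \<sigma> \<rho> where "bij \<sigma>" "bij \<rho>" "\<And>i j. \<tau> (i, j) = (\<sigma> i, \<rho> j)"
proof -
  have fills: "\<exists>j. \<tau> (i, j) = (s, c)" if "\<forall>j. fst (\<tau> (i, j)) = s" for i s c
  proof -
    have "inj (\<lambda>j. snd (\<tau> (i, j)))"
    proof (rule injI)
      fix x y assume "snd (\<tau> (i, x)) = snd (\<tau> (i, y))"
      with that have "\<tau> (i, x) = \<tau> (i, y)" by (simp add: prod_eq_iff)
      then show "x = y" using inj by (auto dest: injD)
    qed
    then have "surj (\<lambda>j. snd (\<tau> (i, j)))" by (simp add: finite_UNIV_inj_surj)
    then obtain j where "c = snd (\<tau> (i, j))" by (rule surjE)
    with that have "\<tau> (i, j) = (s, c)" by (simp add: prod_eq_iff)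
    then show ?thesis ..
  qed
  have fills': "\<exists>j. \<tau> (i, j) = (s, c)" if "\<forall>j. snd (\<tau> (i, j)) = c" for i s c
  proof -
    have "inj (\<lambda>j. fst (\<tau> (i, j)))"
    proof (rule injI)
      fix x y assume "fst (\<tau> (i, x)) = fst (\<tau> (i, y))"
      with that have "\<tau> (i, x) = \<tau> (i, y)" by (simp add: prod_eq_iff)
      then show "x = y" using inj by (auto dest: injD)
    qed
    then have "surj (\<lambda>j. fst (\<tau> (i, j)))" by (simp add: finite_UNIV_inj_surj)
    then obtain j where "s = fst (\<tau> (i, j))" by (rule surjE)
    with that have "\<tau> (i, j) = (s, c)" by (simp add: prod_eq_iff)
    then show ?thesis ..
  qed
  have "\<exists>s. \<forall>j. fst (\<tau> (i, j)) = s" for i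
  proof (cases "i = i\<^sub>0")
    case True
    then show ?thesis using row by blast
  next
    case False
    \<comment> \<open>If row \<open>i\<close> filled a column, it would meet the image of row
      \<open>i\<^sub>0\<close> at \<open>(r, c)\<close>, against injectivity.\<close>
    have "\<not> (\<forall>j. snd (\<tau> (i, j)) = c)" for c
    proof
      assume "\<forall>j. snd (\<tau> (i, j)) = c"
      then obtain j where "\<tau> (i, j) = (r, c)" using fills' by blast
      moreover obtain j' where "\<tau> (i\<^sub>0, j') = (r, c)" using fills[OF row] by blast
      ultimately show False using False inj by (metis injD prod.inject)
    qed
    then show ?thesis using row_to_line[OF inj col n, of i] by blast
  qed
  then obtain \<sigma> where \<sigma>: "\<And>i j. fst (\<tau> (i, j)) = \<sigma> i" by metis
  have inj\<sigma>: "inj \<sigma>"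
  proof (rule injI)
    fix i i' assume e: "\<sigma> i = \<sigma> i'"
    obtain j where "\<tau> (i, j) = (\<sigma> i, r)" using fills \<sigma> by blast
    moreover obtain j' where "\<tau> (i', j') = (\<sigma> i, r)" using fills \<sigma> e by metis
    ultimately show "i = i'" using inj by (metis injD prod.inject)
  qed
  define \<rho> where "\<rho> j = snd (\<tau> (i\<^sub>0, j))" for j
  \<comment> \<open>Positions in one column have collinear images, and their rows
    \<open>\<sigma> i\<close> and \<open>\<sigma> i\<^sub>0\<close> are distinct. So they share a
    column.\<close>
  have \<rho>: "snd (\<tau> (i, j)) = \<rho> j" for i j
  proof (cases "i = i\<^sub>0")
    case False
    have "collinear_pos (\<tau> (i, j)) (\<tau> (i\<^sub>0, j))" by (rule col) (simp add: collinear_pos_def)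
    moreover have "\<sigma> i \<noteq> \<sigma> i\<^sub>0" using False inj\<sigma> by (meson injD)
    ultimately show ?thesis by (simp add: collinear_pos_def \<sigma> \<rho>_def)
  qed (simp add: \<rho>_def)
  have \<tau>: "\<tau> (i, j) = (\<sigma> i, \<rho> j)" for i j using \<sigma> \<rho> by (simp add: prod_eq_iff)
  have "inj \<rho>"
  proof (rule injI)
    fix j j' assume "\<rho> j = \<rho> j'"
    then have "\<tau> (i\<^sub>0, j) = \<tau> (i\<^sub>0, j')" by (simp add: \<tau>)
    then show "j = j'" using inj by (metis injD prod.inject)
  qed
  with inj\<sigma> have "bij \<sigma>" "bij \<rho>" by (simp_all add: bij_betw_def finite_UNIV_inj_surj)
  then show thesis using that \<tau> by blast
qed

lemma collinearity_preserver:
  fixes \<tau> :: "'n::finite \<times> 'n \<Rightarrow> 'n \<times> 'n"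
  assumes inj: "inj \<tau>" and col: "\<And>p q. collinear_pos p q \<Longrightarrow> collinear_pos (\<tau> p) (\<tau> q)"
    and n: "CARD('n) \<ge> 2"
  obtains \<sigma> \<rho> where "bij \<sigma>" "bij \<rho>"
    "(\<forall>i j. \<tau> (i, j) = (\<sigma> i, \<rho> j)) \<or> (\<forall>i j. \<tau> (i, j) = (\<rho> j, \<sigma> i))"
proof -
  fix i :: 'n
  consider r where "\<forall>j. fst (\<tau> (i, j)) = r" | c where "\<forall>j. snd (\<tau> (i, j)) = c"
    using row_to_line[OF inj col n, of i] by blast
  then show thesis
  proof cases
    case 1
    obtain \<sigma> \<rho> where "bij \<sigma>" "bij \<rho>" "\<And>i j. \<tau> (i, j) = (\<sigma> i, \<rho> j)"
      using collinearity_preserver_rows[OF inj col n 1] by blast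
    then show thesis using that by blast
  next
    case 2
    let ?\<tau> = "prod.swap \<circ> \<tau>"
    have inj': "inj ?\<tau>" using inj by (simp add: inj_compose)
    have col': "collinear_pos (?\<tau> p) (?\<tau> q)" if "collinear_pos p q" for p q
      using col[OF that] by (auto simp: collinear_pos_def)
    have row': "\<forall>j. fst (?\<tau> (i, j)) = c" using 2 by simp
    obtain \<sigma> \<rho> where \<sigma>: "bij \<sigma>" "bij \<rho>" "\<And>i j. ?\<tau> (i, j) = (\<sigma> i, \<rho> j)"
      using collinearity_preserver_rows[OF inj' col' n row'] by blast
    have "\<tau> (i, j) = (\<rho> j, \<sigma> i)" for i j
      using \<sigma>(3)[of i j] by (cases "\<tau> (i, j)") simp
    then show thesis using that \<sigma>(1,2) by blast
  qed
qed

section \<open>Entrywise scalings preserving the rank bound\<close>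

text \<open>
  The test matrix is \<open>[[1, 1], [1, -1]]\<close> in rows \<open>r, p\<close> and columns \<open>x, y\<close>, completed by \<open>k - 1\<close>
  ones on a disjoint partial diagonal.
\<close>

lemma scaling_minor_eq:
  fixes c :: "'n::finite \<Rightarrow> 'n \<Rightarrow> 'a::idom"
  assumes pres: "\<And>A :: 'a^'n^'n. A \<in> prk_le k \<Longrightarrow> (\<chi> i j. c i j * A $ i $ j) \<in> prk_le k"
    and nz: "\<And>i j. c i j \<noteq> 0" and k: "1 \<le> k" "k \<le> CARD('n) - 1"
    and rp: "r \<noteq> p" and xy: "x \<noteq> y"
  shows "c r x * c p y = c r y * c p x"
proof -
  have n: "card {r, p} \<le> CARD('n)" by (rule card_mono) auto
  then have "(k - 1) + card {r, p} \<le> CARD('n)" using rp k by simp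
  then obtain I where I: "I \<inter> {r, p} = {}" "card I = k - 1"
    by (rule obtain_card_between[of "{}" "{r, p}" "k - 1", rotated 2]) auto
  have "card (- {x, y}) = CARD('n) - 2"
    using xy by (simp add: Compl_eq_Diff_UNIV card_Diff_subset)
  then have "card I \<le> card (- {x, y})" using I(2) k by simp
  then obtain e where e: "e ` I \<subseteq> - {x, y}" "inj_on e I"
    using card_le_inj[of I "- {x, y}"] by auto
  let ?I = "I \<union> {r, p}" and ?J = "e ` I \<union> {x, y}"
  have cI: "card ?I = k + 1" using I k rp by (subst card_Un_disjoint) auto
  have cJ: "card ?J = k + 1"
    using e I(2) k xy by (subst card_Un_disjoint) (auto simp: card_image)
  define A :: "'a^'n^'n" where "A = (\<chi> i j. if i \<in> I then (if j = e i then 1 else 0)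
    else if (i, j) \<in> {(r, x), (r, y), (p, x)} then 1 else if (i, j) = (p, y) then - 1 else 0)"
  have rpI: "r \<notin> I" "p \<notin> I" using I(1) by auto
  have xyI: "x \<notin> e ` I" "y \<notin> e ` I" using e(1) by auto
  \<comment> \<open>The weight \<open>d\<close> is kept general: the constant weight 1 shows that
    \<open>A\<close> itself has vanishing permanent here, and \<open>d = c\<close> yields the minor
    of the scalars.\<close>
  have sp: "sub_permanent (\<chi> i j. d i j * A $ i $ j) ?I ?J =
      (\<Prod>s\<in>I. d s (e s)) * (d r y * d p x - d r x * d p y)" for d
  proof -
    have "sub_permanent (\<chi> i j. d i j * A $ i $ j) ?I ?J =
       (\<Prod>s\<in>I. (\<chi> i j. d i j * A $ i $ j) $ s $ e s) *
       ((\<chi> i j. d i j * A $ i $ j) $ r $ x * (\<chi> i j. d i j * A $ i $ j) $ p $ y +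
        (\<chi> i j. d i j * A $ i $ j) $ r $ y * (\<chi> i j. d i j * A $ i $ j) $ p $ x)"
      using rpI xyI rp xy e(2) by (intro sub_permanent_monomial_rows) (auto simp: A_def)
    also have "\<dots> = (\<Prod>s\<in>I. d s (e s)) * (d r y * d p x - d r x * d p y)"
      using rpI rp xy by (simp add: A_def)
    finally show ?thesis .
  qed
  have "A \<in> prk_le k"
    unfolding prk_le_iff
  proof (intro allI impI, rule ccontr)
    fix I' J' :: "'n set"
    assume c: "card I' = card J'" "k < card I'" and nz: "sub_permanent A I' J' \<noteq> 0"
    obtain f where f: "bij_betw f I' J'" "\<And>i. i \<in> I' \<Longrightarrow> A $ i $ f i \<noteq> 0"
      using nz by (rule sub_permanent_nonzeroE) blast
    have "i \<in> ?I \<and> f i \<in> ?J" if "i \<in> I'" for i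
      using f(2)[OF that] by (auto simp: A_def split: if_splits)
    then have "I' \<subseteq> ?I" "J' \<subseteq> ?J" using f(1) by (auto simp: bij_betw_def)
    then have "I' = ?I" "J' = ?J"
      using c cI cJ card_seteq[of ?I I'] card_seteq[of ?J J'] by simp_all
    moreover have "(\<chi> i j. 1 * A $ i $ j) = A" by (simp add: vec_eq_iff)
    ultimately show False using nz sp[of "\<lambda>_ _. 1"] by simp
  qed
  then have "(\<chi> i j. c i j * A $ i $ j) \<in> prk_le k" by (rule pres)
  then have "sub_permanent (\<chi> i j. c i j * A $ i $ j) ?I ?J = 0"
    by (rule prk_leD) (use cI cJ in linarith)+
  then show ?thesis using sp[of c] nz by simp
qed

text \<open>The vanishing of the minors through one fixed position
  \<open>(o\<^sub>1, o\<^sub>1)\<close> already forces rank one.\<close>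

lemma scaling_factorizes:
  fixes c :: "'n::finite \<Rightarrow> 'n \<Rightarrow> 'a::field"
  assumes pres: "\<And>A :: 'a^'n^'n. A \<in> prk_le k \<Longrightarrow> (\<chi> i j. c i j * A $ i $ j) \<in> prk_le k"
    and nz: "\<And>i j. c i j \<noteq> 0" and k: "1 \<le> k" "k \<le> CARD('n) - 1"
  obtains a b where "\<And>i. a i \<noteq> 0" "\<And>j. b j \<noteq> 0" "\<And>i j. c i j = a i * b j"
proof -
  fix o\<^sub>1 :: 'n
  have "c i j * c o\<^sub>1 o\<^sub>1 = c i o\<^sub>1 * c o\<^sub>1 j" for i j
    using scaling_minor_eq[OF pres nz k, of i o\<^sub>1 j o\<^sub>1]
    by (cases "i = o\<^sub>1"; cases "j = o\<^sub>1") (auto simp: mult.commute)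
  then have c: "c i j = c i o\<^sub>1 / c o\<^sub>1 o\<^sub>1 * c o\<^sub>1 j" for i j
    using nz by (simp add: field_simps)
  show thesis
    by (rule that[of "\<lambda>i. c i o\<^sub>1 / c o\<^sub>1 o\<^sub>1" "c o\<^sub>1"]) (simp_all only: c[symmetric], simp_all add: nz)
qed

section \<open>Preservers\<close>

locale prk_le_preserver =
  fixes T :: "'a::field^'n^'n \<Rightarrow> 'a^'n^'n" and k :: nat
  assumes two: "(2::'a) \<noteq> 0" and n: "CARD('n) \<ge> 3" and k: "1 \<le> k" "k \<le> CARD('n) - 1"
    and lin: "Vector_Spaces.linear mat_scale mat_scale T" and bij: "bij T"
    and pres: "T ` prk_le k \<subseteq> prk_le k"
begin

sublocale T: Vector_Spaces.linear mat_scale mat_scale T by (rule lin)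

text \<open>An injective linear map keeps the dimension \<open>CARD('n) * k\<close>, so the image is
  again a subspace of maximal dimension inside \<open>prk_le k\<close>.\<close>

lemma image_line_unions:
  assumes "S \<in> line_unions k"
  obtains S' where "S' \<in> line_unions k" "T ` supported_on S = supported_on S'"
proof (rule max_dim_subspace_prk_le[OF _ _ _ two n k(2)])
  show "mat.subspace (T ` supported_on S)" by (rule mat.linear_subspace_image[OF lin subspace_supported_on])
  show "T ` supported_on S \<subseteq> prk_le k"
    using supported_on_line_unions_prk_le[OF assms] pres by blast
  have "inj_on T (mat.span (supported_on S))" using bij by (auto simp: bij_betw_def inj_on_def)
  then show "mat.dim (T ` supported_on S) = CARD('n) * k"
    using mat.dim_image_eq[OF lin] by (simp add: dim_supported_on card_line_unions[OF assms])
qed (rule that)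

text \<open>Choose a nonzero entry \<open>(i, j)\<close> of the image of the matrix unit at
  \<open>p\<close> and pull the matrix unit at \<open>(i, j)\<close> back to \<open>D\<close>.
  Whenever \<open>S\<close> in \<open>line_unions k\<close> contains \<open>p\<close>, its image
  support contains \<open>(i, j)\<close>, hence \<open>D\<close> is supported on \<open>S\<close>.
  Separating \<open>p\<close> from all other positions leaves \<open>D\<close> supported at
  \<open>p\<close> alone.\<close>

lemma image_unit_mat: "\<exists>q c. c \<noteq> 0 \<and> T (unit_mat p) = mat_scale c (unit_mat q)"
proof -
  have "unit_mat p \<noteq> (0 :: 'a^'n^'n)"
    by (metis unit_mat_nth prod.collapse zero_index zero_neq_one)
  then have "T (unit_mat p) \<noteq> 0"
    using bij T.zero by (metis bij_is_inj injD)
  then obtain i j where ij: "T (unit_mat p) $ i $ j \<noteq> 0" by (auto simp: vec_eq_iff)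
  obtain D where D: "T D = unit_mat (i, j)" using bij by (metis bij_pointE)
  have "D $ i' $ j' = 0" if ne: "(i', j') \<noteq> p" for i' j'
  proof -
    obtain S where S: "S \<in> line_unions k" "p \<in> S" "(i', j') \<notin> S"
      using line_unions_separate[OF ne[symmetric] k] .
    obtain S' where S': "T ` supported_on S = supported_on S'"
      using image_line_unions[OF S(1)] by blast
    have "T (unit_mat p) \<in> supported_on S'" using S(2) by (auto simp flip: S')
    then have "(i, j) \<in> S'" using ij by (auto simp: supported_on_def)
    then have "T D \<in> T ` supported_on S" by (simp add: D S')
    then have "D \<in> supported_on S" using bij by (auto dest: injD simp: bij_betw_def)
    then show ?thesis using S(3) by (auto simp: supported_on_def)
  qed
  then have "D = mat_scale (D $ fst p $ snd p) (unit_mat p)"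
    by (auto simp: vec_eq_iff unit_mat_nth)
  then have e: "unit_mat (i, j) = mat_scale (D $ fst p $ snd p) (T (unit_mat p))"
    using D T.scale by metis
  then have "(unit_mat (i, j) :: 'a^'n^'n) $ i $ j = D $ fst p $ snd p * T (unit_mat p) $ i $ j"
    by (metis mat_scale_nth)
  then have nz: "D $ fst p $ snd p \<noteq> 0" by (auto simp: unit_mat_nth)
  have "T (unit_mat p) = mat_scale (inverse (D $ fst p $ snd p)) (unit_mat (i, j))"
    unfolding e using nz by (simp add: vec_eq_iff)
  then show ?thesis using nz by (metis inverse_nonzero_iff_nonzero)
qed

definition pos :: "'n \<times> 'n \<Rightarrow> 'n \<times> 'n" where
  "pos p = (SOME q. \<exists>c. c \<noteq> 0 \<and> T (unit_mat p) = mat_scale c (unit_mat q))"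

definition coef :: "'n \<times> 'n \<Rightarrow> 'a" where
  "coef p = (SOME c. c \<noteq> 0 \<and> T (unit_mat p) = mat_scale c (unit_mat (pos p)))"

lemma coef_nonzero: "coef p \<noteq> 0"
  and T_unit_mat: "T (unit_mat p) = mat_scale (coef p) (unit_mat (pos p))"
proof -
  have "\<exists>c. c \<noteq> 0 \<and> T (unit_mat p) = mat_scale c (unit_mat (pos p))"
    unfolding pos_def by (rule someI_ex[OF image_unit_mat])
  from someI_ex[OF this] show "coef p \<noteq> 0"
    and "T (unit_mat p) = mat_scale (coef p) (unit_mat (pos p))"
    unfolding coef_def by auto
qed

lemma inj_pos: "inj pos"
proof (rule injI)
  fix p q assume e: "pos p = pos q"
  have "T (mat_scale (coef q) (unit_mat p)) = T (mat_scale (coef p) (unit_mat q))"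
    by (simp add: T.scale T_unit_mat e vec_eq_iff mult_ac)
  then have "mat_scale (coef q) (unit_mat p :: 'a^'n^'n) = mat_scale (coef p) (unit_mat q)"
    using bij by (metis bij_is_inj injD)
  then have "mat_scale (coef q) (unit_mat p :: 'a^'n^'n) $ fst p $ snd p =
      mat_scale (coef p) (unit_mat q) $ fst p $ snd p" by simp
  then show "p = q" using coef_nonzero by (simp add: unit_mat_nth split: if_splits)
qed

lemma bij_pos: "bij pos"
  using inj_pos by (simp add: bij_betw_def finite_UNIV_inj_surj)

lemma T_nth_pos: "T A $ fst (pos p) $ snd (pos p) = coef p * A $ fst p $ snd p"
proof -
  have "A = (\<Sum>q\<in>UNIV. mat_scale (A $ fst q $ snd q) (unit_mat q))"
    by (rule supported_on_expand) (simp add: supported_on_def)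
  then have "T A = (\<Sum>q\<in>UNIV. mat_scale (A $ fst q $ snd q) (T (unit_mat q)))"
    by (metis (no_types, lifting) T.sum T.scale sum.cong)
  then have "T A $ fst (pos p) $ snd (pos p) =
      (\<Sum>q\<in>UNIV. A $ fst q $ snd q * (coef q * (if pos p = pos q then 1 else 0)))"
    by (simp add: T_unit_mat unit_mat_nth mult.assoc)
  also have "\<dots> = (\<Sum>q\<in>UNIV. if p = q then A $ fst q $ snd q * coef q else 0)"
    using inj_pos by (intro sum.cong) (auto dest: injD)
  finally show ?thesis by (simp add: mult.commute)
qed

text \<open>Images that are not collinear would lie on a partial diagonal \<open>M\<close> of
  \<open>k + 1\<close> positions. The 0/1 matrix on the preimage of \<open>M\<close> then has an
  image outside \<open>prk_le k\<close>, so it lies outside too. A nonzero term of one of its large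
  permanents must use all \<open>k + 1\<close> preimage positions, including the collinear pair
  \<open>p\<close> and \<open>q\<close>.\<close>

lemma collinear_pos_preserved:
  assumes "collinear_pos p q"
  shows "collinear_pos (pos p) (pos q)"
proof (rule ccontr)
  assume ncol: "\<not> collinear_pos (pos p) (pos q)"
  then have pq: "p \<noteq> q" by (auto simp: collinear_pos_def)
  from ncol have ne: "fst (pos p) \<noteq> fst (pos q)" "snd (pos p) \<noteq> snd (pos q)"
    by (auto simp: collinear_pos_def)
  obtain \<sigma> where \<sigma>: "bij \<sigma>" "\<sigma> (fst (pos p)) = snd (pos p)" "\<sigma> (fst (pos q)) = snd (pos q)"
    using ex_bij_two_values[OF ne] .
  have c: "card {fst (pos p), fst (pos q)} \<le> k + 1" "k + 1 + card ({} :: 'n set) \<le> CARD('n)"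
    using ne k n by auto
  obtain I where I: "{fst (pos p), fst (pos q)} \<subseteq> I" "card I = k + 1"
    by (rule obtain_card_between[OF _ c]) auto
  define M where "M = (\<lambda>i. (i, \<sigma> i)) ` I"
  have cardM: "card M = k + 1"
    unfolding M_def by (subst card_image) (auto simp: I inj_on_def)
  have inM: "pos p \<in> M" "pos q \<in> M" using I \<sigma> by (auto simp: M_def image_iff prod_eq_iff)
  define A :: "'a^'n^'n" where "A = (\<chi> i j. if pos (i, j) \<in> M then 1 else 0)"
  have TA: "T A $ i $ j = (if (i, j) \<in> M then coef (inv pos (i, j)) else 0)" for i j
    using T_nth_pos[of A "inv pos (i, j)"] bij_pos
    by (simp add: A_def bij_betw_def surj_f_inv_f)
  obtain h :: "'n \<Rightarrow> nat" where h: "inj h"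
    using finite_imp_inj_to_nat_seg[of "UNIV :: 'n set"] by auto
  have inj\<sigma>: "inj_on \<sigma> I" using \<sigma>(1) by (auto simp: bij_betw_def inj_on_def)
  have "sub_permanent (T A) I (\<sigma> ` I) = (\<Prod>i\<in>I. T A $ i $ \<sigma> i)"
    by (rule sub_permanent_triangular[OF h inj\<sigma>]) (auto simp: TA M_def)
  also have "\<dots> \<noteq> 0" by (simp add: TA M_def coef_nonzero)
  finally have "T A \<notin> prk_le k"
    using prk_leD[of "T A" k I "\<sigma> ` I"] I(2) inj\<sigma> by (auto simp: card_image)
  then have "A \<notin> prk_le k" using pres by blast
  then obtain I' J where c: "card I' = card J" "k < card I'" and nz: "sub_permanent A I' J \<noteq> 0"
    unfolding prk_le_iff by blast
  obtain f where f: "bij_betw f I' J" "\<And>i. i \<in> I' \<Longrightarrow> A $ i $ f i \<noteq> 0"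
    using nz by (rule sub_permanent_nonzeroE) blast
  have sub: "(\<lambda>i. (i, f i)) ` I' \<subseteq> pos -` M"
  proof safe
    fix i assume "i \<in> I'"
    from f(2)[OF this] show "(i, f i) \<in> pos -` M" by (simp add: A_def split: if_splits)
  qed
  have "card (pos -` M) = k + 1"
    using cardM bij_pos by (metis bij_is_inj bij_is_surj card_vimage_inj subset_UNIV)
  moreover have "card ((\<lambda>i. (i, f i)) ` I') = card I'"
    by (rule card_image) (auto simp: inj_on_def)
  ultimately have "(\<lambda>i. (i, f i)) ` I' = pos -` M"
    using c by (intro card_seteq[OF _ sub]) auto
  with inM have "p \<in> (\<lambda>i. (i, f i)) ` I'" "q \<in> (\<lambda>i. (i, f i)) ` I'" by auto
  then show False
    using assms pq f(1) by (auto simp: collinear_pos_def bij_betw_def dest: inj_onD)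
qed

lemma standard_form:
  obtains \<alpha> \<beta> a b where "bij \<alpha>" "bij \<beta>" "\<And>i. a i \<noteq> 0" "\<And>j. b j \<noteq> 0"
    "(\<forall>A i j. T A $ i $ j = a i * A $ \<alpha> i $ \<beta> j * b j) \<or>
     (\<forall>A i j. T A $ i $ j = a i * transpose A $ \<alpha> i $ \<beta> j * b j)"
proof -
  have "CARD('n) \<ge> 2" using n by simp
  then obtain \<sigma> \<rho> where \<sigma>: "bij \<sigma>" "bij \<rho>"
    "(\<forall>i j. pos (i, j) = (\<sigma> i, \<rho> j)) \<or> (\<forall>i j. pos (i, j) = (\<rho> j, \<sigma> i))"
    using collinearity_preserver[OF inj_pos collinear_pos_preserved] by blast
  have inv: "bij (inv \<sigma>)" "bij (inv \<rho>)" "\<And>i. \<sigma> (inv \<sigma> i) = i" "\<And>i. \<rho> (inv \<rho> i) = i"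
    using \<sigma> by (auto simp: bij_imp_bij_inv bij_is_surj surj_f_inv_f)
  \<comment> \<open>Undoing the permutation of positions in \<open>T A\<close>, after transposing it
    if rows became columns, leaves \<open>A\<close> multiplied entrywise by
    \<open>coef\<close>.\<close>
  have scal: "(\<chi> i j. coef (i, j) * A $ i $ j) \<in> prk_le k" if A: "A \<in> prk_le k" for A
    using \<sigma>(3)
  proof
    assume s: "\<forall>i j. pos (i, j) = (\<sigma> i, \<rho> j)"
    show ?thesis
    proof (rule scale_permute_in_prk_le[OF _ \<sigma>(1,2)])
      show "T A \<in> prk_le k" using A pres by blast
      show "(\<chi> i j. coef (i, j) * A $ i $ j) $ i $ j = (\<lambda>_. 1) i * T A $ \<sigma> i $ \<rho> j * (\<lambda>_. 1) j" for i j
        using T_nth_pos[of A "(i, j)"] s by simp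
    qed
  next
    assume s: "\<forall>i j. pos (i, j) = (\<rho> j, \<sigma> i)"
    show ?thesis
    proof (rule scale_permute_in_prk_le[OF _ \<sigma>(1,2)])
      show "transpose (T A) \<in> prk_le k" using A pres by (intro transpose_in_prk_le) blast
      show "(\<chi> i j. coef (i, j) * A $ i $ j) $ i $ j =
          (\<lambda>_. 1) i * transpose (T A) $ \<sigma> i $ \<rho> j * (\<lambda>_. 1) j" for i j
        using T_nth_pos[of A "(i, j)"] s by (simp add: transpose_def)
    qed
  qed
  obtain a b where ab: "\<And>i. a i \<noteq> 0" "\<And>j. b j \<noteq> 0" "\<And>i j. coef (i, j) = a i * b j"
    using scaling_factorizes[where c = "\<lambda>i j. coef (i, j)", OF scal coef_nonzero k] by metis
  from \<sigma>(3) show thesis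
  proof
    assume s: "\<forall>i j. pos (i, j) = (\<sigma> i, \<rho> j)"
    have "T A $ i $ j = a (inv \<sigma> i) * A $ inv \<sigma> i $ inv \<rho> j * b (inv \<rho> j)" for A i j
      using T_nth_pos[of A "(inv \<sigma> i, inv \<rho> j)"] s by (simp add: inv ab(3) mult_ac)
    then show thesis using that[OF inv(1,2), of "\<lambda>i. a (inv \<sigma> i)" "\<lambda>j. b (inv \<rho> j)"] ab by blast
  next
    assume s: "\<forall>i j. pos (i, j) = (\<rho> j, \<sigma> i)"
    have "T A $ i $ j = b (inv \<rho> i) * transpose A $ inv \<rho> i $ inv \<sigma> j * a (inv \<sigma> j)" for A i j
      using T_nth_pos[of A "(inv \<sigma> j, inv \<rho> i)"] s by (simp add: inv ab(3) mult_ac transpose_def)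
    then show thesis using that[OF inv(2,1), of "\<lambda>i. b (inv \<rho> i)" "\<lambda>j. a (inv \<sigma> j)"] ab by blast
  qed
qed

end

section \<open>The standard form as a matrix product\<close>

lemma diagonal_perm_matrix_mult_nth:
  fixes A D\<^sub>1 D\<^sub>2 :: "'a::field^'n^'n"
  assumes "diagonal_matrix D\<^sub>1" "diagonal_matrix D\<^sub>2" "bij \<sigma>\<^sub>2"
  shows "(D\<^sub>1 ** perm_matrix \<sigma>\<^sub>1 ** A ** perm_matrix \<sigma>\<^sub>2 ** D\<^sub>2) $ i $ j =
    D\<^sub>1 $ i $ i * A $ inv \<sigma>\<^sub>1 i $ \<sigma>\<^sub>2 j * D\<^sub>2 $ j $ j"
proof -
  have D1: "(D\<^sub>1 ** B) $ i $ j = D\<^sub>1 $ i $ i * B $ i $ j" for B :: "'a^'n^'n" and i j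
  proof -
    have "(\<Sum>l\<in>UNIV. D\<^sub>1 $ i $ l * B $ l $ j) = (\<Sum>l\<in>{i}. D\<^sub>1 $ i $ l * B $ l $ j)"
      using assms(1) by (intro sum.mono_neutral_right) (auto simp: diagonal_matrix_def)
    then show ?thesis by (simp add: matrix_matrix_mult_def)
  qed
  have D2: "(B ** D\<^sub>2) $ i $ j = B $ i $ j * D\<^sub>2 $ j $ j" for B :: "'a^'n^'n" and i j
  proof -
    have "(\<Sum>l\<in>UNIV. B $ i $ l * D\<^sub>2 $ l $ j) = (\<Sum>l\<in>{j}. B $ i $ l * D\<^sub>2 $ l $ j)"
      using assms(2) by (intro sum.mono_neutral_right) (auto simp: diagonal_matrix_def)
    then show ?thesis by (simp add: matrix_matrix_mult_def)
  qed
  have P1: "(perm_matrix \<sigma>\<^sub>1 ** B) $ i $ j = B $ inv \<sigma>\<^sub>1 i $ j" for B :: "'a^'n^'n" and i j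
    by (simp add: matrix_matrix_mult_def perm_matrix_def if_distrib[of "\<lambda>x. x * _"] cong: if_cong)
  have P2: "(B ** perm_matrix \<sigma>\<^sub>2) $ i $ j = B $ i $ \<sigma>\<^sub>2 j" for B :: "'a^'n^'n" and i j
  proof -
    have "j = inv \<sigma>\<^sub>2 l \<longleftrightarrow> l = \<sigma>\<^sub>2 j" for l
      using assms(3) by (metis bij_inv_eq_iff)
    then show ?thesis
      by (simp add: matrix_matrix_mult_def perm_matrix_def if_distrib[of "\<lambda>x. _ * x"] cong: if_cong)
  qed
  show ?thesis unfolding D2 P2 by (simp add: P1 D1 flip: matrix_mul_assoc)
qed

theorem theorem1p2:
  fixes T :: "'a::field^'n^'n \<Rightarrow> 'a^'n^'n" and k :: nat
  assumes "CHAR('a) \<noteq> 2"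
    and "CARD('n) \<ge> 3"
    and "1 \<le> k" and "k \<le> CARD('n) - 1"
    and "Vector_Spaces.linear mat_scale mat_scale T"
    and "bij T"
  shows "T ` prk_le k \<subseteq> prk_le k \<longleftrightarrow>
    (\<exists>\<sigma>\<^sub>1 \<sigma>\<^sub>2 :: 'n \<Rightarrow> 'n. \<exists>D\<^sub>1 D\<^sub>2 :: 'a^'n^'n.
      \<sigma>\<^sub>1 permutes UNIV \<and> \<sigma>\<^sub>2 permutes UNIV \<and>
      diagonal_matrix D\<^sub>1 \<and> (\<forall>i. D\<^sub>1 $ i $ i \<noteq> 0) \<and>
      diagonal_matrix D\<^sub>2 \<and> (\<forall>i. D\<^sub>2 $ i $ i \<noteq> 0) \<and>
      ((\<forall>A. T A = D\<^sub>1 ** perm_matrix \<sigma>\<^sub>1 ** A ** perm_matrix \<sigma>\<^sub>2 ** D\<^sub>2) \<or>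
       (\<forall>A. T A = D\<^sub>1 ** perm_matrix \<sigma>\<^sub>1 ** transpose A ** perm_matrix \<sigma>\<^sub>2 ** D\<^sub>2)))"
  (is "?L \<longleftrightarrow> ?R")
proof
  assume ?L
  have "(2::'a) \<noteq> 0"
  proof
    assume "(2::'a) = 0"
    \<comment> \<open>A characteristic dividing 2 is 1 or 2; a field excludes 1 and the assumption
      excludes 2.\<close>
    then have "CHAR('a) dvd 2" using of_nat_eq_0_iff_char_dvd[where ?'a = 'a, of 2] by simp
    moreover from this have "CHAR('a) \<noteq> 0" by (metis dvd_0_left_iff zero_neq_numeral)
    ultimately have "CHAR('a) \<le> 2" "CHAR('a) \<noteq> 0" by (auto dest: dvd_imp_le)
    then show False using assms(1) CHAR_not_1[where ?'a = 'a] by linarith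
  qed
  then interpret prk_le_preserver T k
    using assms(2-) \<open>?L\<close> by (intro prk_le_preserver.intro) auto
  obtain \<alpha> \<beta> a b where *: "bij \<alpha>" "bij \<beta>" "\<And>i. a i \<noteq> 0" "\<And>j. b j \<noteq> 0"
    "(\<forall>A i j. T A $ i $ j = a i * A $ \<alpha> i $ \<beta> j * b j) \<or>
     (\<forall>A i j. T A $ i $ j = a i * transpose A $ \<alpha> i $ \<beta> j * b j)"
    by (rule standard_form) blast
  define D\<^sub>1 :: "'a^'n^'n" where "D\<^sub>1 = (\<chi> i j. if i = j then a i else 0)"
  define D\<^sub>2 :: "'a^'n^'n" where "D\<^sub>2 = (\<chi> i j. if i = j then b i else 0)"
  have D: "diagonal_matrix D\<^sub>1" "diagonal_matrix D\<^sub>2" "\<And>i. D\<^sub>1 $ i $ i = a i" "\<And>i. D\<^sub>2 $ i $ i = b i"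
    by (auto simp: D\<^sub>1_def D\<^sub>2_def diagonal_matrix_def)
  \<comment> \<open>A permutation matrix on the left selects rows by the inverse permutation, one on
    the right selects columns by the permutation itself. Hence \<open>inv \<alpha>\<close> stands on
    the left and \<open>\<beta>\<close> on the right.\<close>
  have form: "(D\<^sub>1 ** perm_matrix (inv \<alpha>) ** A ** perm_matrix \<beta> ** D\<^sub>2) $ i $ j =
      a i * A $ \<alpha> i $ \<beta> j * b j" for A i j
    using diagonal_perm_matrix_mult_nth[OF D(1,2) *(2), of "inv \<alpha>" A i j] *(1)
    by (simp add: D inv_inv_eq)
  have "inv \<alpha> permutes UNIV" "\<beta> permutes UNIV"
    using *(1,2) by (auto intro!: bij_imp_permutes bij_imp_bij_inv)
  moreover have "(\<forall>A. T A = D\<^sub>1 ** perm_matrix (inv \<alpha>) ** A ** perm_matrix \<beta> ** D\<^sub>2) \<or>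
      (\<forall>A. T A = D\<^sub>1 ** perm_matrix (inv \<alpha>) ** transpose A ** perm_matrix \<beta> ** D\<^sub>2)"
    using *(5) by (simp add: vec_eq_iff form)
  ultimately show ?R using D *(3,4) by metis
next
  assume ?R
  then obtain \<sigma>\<^sub>1 \<sigma>\<^sub>2 :: "'n \<Rightarrow> 'n" and D\<^sub>1 D\<^sub>2 :: "'a^'n^'n" where
    \<sigma>: "\<sigma>\<^sub>1 permutes UNIV" "\<sigma>\<^sub>2 permutes UNIV" and D: "diagonal_matrix D\<^sub>1" "diagonal_matrix D\<^sub>2"
    and T: "(\<forall>A. T A = D\<^sub>1 ** perm_matrix \<sigma>\<^sub>1 ** A ** perm_matrix \<sigma>\<^sub>2 ** D\<^sub>2) \<or>
      (\<forall>A. T A = D\<^sub>1 ** perm_matrix \<sigma>\<^sub>1 ** transpose A ** perm_matrix \<sigma>\<^sub>2 ** D\<^sub>2)"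
    by blast
  have b: "bij (inv \<sigma>\<^sub>1)" "bij \<sigma>\<^sub>2"
    using \<sigma> by (auto intro: bij_imp_bij_inv permutes_bij)
  have "D\<^sub>1 ** perm_matrix \<sigma>\<^sub>1 ** A ** perm_matrix \<sigma>\<^sub>2 ** D\<^sub>2 \<in> prk_le k" if "A \<in> prk_le k" for A
    by (rule scale_permute_in_prk_le[OF that b diagonal_perm_matrix_mult_nth[OF D b(2)]])
  then show ?L using T transpose_in_prk_le by (metis image_subsetI)
qed

end
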